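(* For any realization $x_1,\dots,x_n$ of $X_1,\dots,X_n$, any integer $m\ge1$ and any $0\le\varepsilon\le1$, for each choice of the sign $\pm$, $$\mathbb P\Big(\pm\big(\hat L_m(\hat g_1^n)-\mathbb L(\hat g_1^n)\big)>\varepsilon\Big)\le\Big(2\exp\Big(\frac{\ln 2}{t_{mix}}\Big)+1\Big)\exp\Big(-\frac{m\varepsilon^2\ln 2}{(1+9\ln 2)\,t_{mix}}\Big).$$
   Context: Process. Let $\mathcal Y$ be a Polish space and $(Y_t)_{t\in\mathbb Z}$ a $\mathcal Y$-valued Markov chain of order $k_0$ that is time homogeneous, stationary and uniformly ergodic. Fix an integer $p\ge k_0$ and put $X_t=(Y_t,Y_{t-1},\dots,Y_{t-p})^T$, with values in $\mathcal X=\mathcal Y^{p+1}$. Then $(X_t)_{t\in\mathbb Z}$ is a time homogeneous, stationary, uniformly ergodic Markov chain of order $1$; $K$ denotes its transition kernel and $Q$ its stationary law. With $d_{TV}(P,P')=\sup_A|P(A)-P'(A)|$, uniform ergodicity means that there are $C>0$ and $0<\rho<1$ with $\sup_{x\in\mathcal X}d_{TV}(K^n(x,\cdot),Q)\le C\rho^n$ for all $n$. The mixing time is $t_{mix}=\min\{t\ge 1:\ \sup_{x\in\mathcal X}d_{TV}(K^t(x,\cdot),Q)\le 1/4\}$. Losses. A prediction function is a measurable $g:\mathcal Y^p\to\mathcal Y$; $\mathcal F$ is the set of all of them. A loss function is a measurable $L:\mathcal Y^2\to[0,1]$; write $L(g(X_t)):=L(g(Y_{t-1},\dots,Y_{t-p}),Y_t)$.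 The expected loss is $\mathbb L(g)=\mathbb E_Q(L(g(X)))$ with $X\sim Q$. The out-of-sample empirical loss on the validation set $(X_{n+1},\dots,X_{n+m})$ is $\hat L_m(g)=\frac1m\sum_{j=n+1}^{n+m}L(g(X_j))$. Estimator. Let $\tilde L$ be a loss function (possibly different from $L$) and $\mathcal G\subset\mathcal F$. For a realization $x_1,\dots,x_n$ of the learning set, $\hat g_1^n\in\arg\min_{g\in\mathcal G}\sum_{t=1}^n\tilde L(g(x_t))$. $\mathbb P$ is taken conditionally on $X_1=x_1,\dots,X_n=x_n$; thus $\hat g_1^n$ is a fixed function, and $(X_{n+j})_{j\ge1}$ is the chain with kernel $K$ started from $X_n=x_n$. *)

theory Defs
  imports "HOL-Probability.Probability"
begin

primrec kernel_power :: "'s measure \<Rightarrow> ('s \<Rightarrow> 's measure) \<Rightarrow> nat \<Rightarrow> 's \<Rightarrow> 's measure" where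
  "kernel_power S K 0 x = return S x"
| "kernel_power S K (Suc n) x = bind (kernel_power S K n x) K"

definition tv_dist :: "'s measure \<Rightarrow> 's measure \<Rightarrow> real" where
  "tv_dist P P' = (SUP A\<in>sets P. \<bar>measure P A - measure P' A\<bar>)"

definition worst_tv :: "'s measure \<Rightarrow> ('s \<Rightarrow> 's measure) \<Rightarrow> 's measure \<Rightarrow> nat \<Rightarrow> real" where
  "worst_tv S K Q n = (SUP x\<in>space S. tv_dist (kernel_power S K n x) Q)"

definition uniformly_ergodic :: "'s measure \<Rightarrow> ('s \<Rightarrow> 's measure) \<Rightarrow> 's measure \<Rightarrow> bool" where
  "uniformly_ergodic S K Q \<longleftrightarrow>
     (\<exists>C>0. \<exists>\<rho>. 0 < \<rho> \<and> \<rho> < 1 \<and> (\<forall>n. worst_tv S K Q n \<le> C * \<rho> ^ n))"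

definition mixing_time :: "'s measure \<Rightarrow> ('s \<Rightarrow> 's measure) \<Rightarrow> 's measure \<Rightarrow> nat" where
  "mixing_time S K Q = (LEAST t. 1 \<le> t \<and> worst_tv S K Q t \<le> 1 / 4)"

text \<open>
  The joint law of \<open>(X\<^sub>n, \<dots>, X\<^sub>n\<^sub>+\<^sub>m)\<close> for the chain with kernel \<open>K\<close> started from
  \<open>X\<^sub>n = x\<close>; a path is an extensional function on \<open>{n..n+m}\<close>.
\<close>

primrec chain_law ::
  "'s measure \<Rightarrow> ('s \<Rightarrow> 's measure) \<Rightarrow> nat \<Rightarrow> 's \<Rightarrow> nat \<Rightarrow> (nat \<Rightarrow> 's) measure" where
  "chain_law S K n x 0 = return (PiM {n..n} (\<lambda>_. S)) (\<lambda>j\<in>{n..n}. x)"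
| "chain_law S K n x (Suc m) =
     bind (chain_law S K n x m)
       (\<lambda>X. distr (K (X (n + m))) (PiM {n..n + Suc m} (\<lambda>_. S)) (\<lambda>z. X(n + Suc m := z)))"

definition past_algebra :: "'a measure \<Rightarrow> (int \<Rightarrow> 'a \<Rightarrow> 'y::topological_space) \<Rightarrow> int \<Rightarrow> 'a measure" where
  "past_algebra M Y t =
     sigma (space M) {Y s -` A \<inter> space M | s A. s < t \<and> A \<in> sets borel}"

text \<open>
  The kernel \<open>\<kappa>\<close> gives the law of \<open>Y\<^sub>t\<close> given the past; its argument is indexed by the lag,
  so that index \<open>i \<in> {1..k}\<close> holds \<open>Y\<^sub>t\<^sub>-\<^sub>i\<close>. Time homogeneity is the independence
  of \<open>\<kappa>\<close> from \<open>t\<close>.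
\<close>

definition markov_chain_of_order ::
  "'a measure \<Rightarrow> nat \<Rightarrow> ((nat \<Rightarrow> 'y::topological_space) \<Rightarrow> 'y measure) \<Rightarrow> (int \<Rightarrow> 'a \<Rightarrow> 'y) \<Rightarrow> bool" where
  "markov_chain_of_order M k \<kappa> Y \<longleftrightarrow>
     \<kappa> \<in> PiM {1..k} (\<lambda>_. borel) \<rightarrow>\<^sub>M prob_algebra borel \<and>
     (\<forall>t. Y t \<in> M \<rightarrow>\<^sub>M borel) \<and>
     (\<forall>t. \<forall>A\<in>sets borel. AE \<omega> in M.
        real_cond_exp M (past_algebra M Y t) (\<lambda>\<omega>. indicator A (Y t \<omega>)) \<omega>
          = measure (\<kappa> (\<lambda>i\<in>{1..k}. Y (t - int i) \<omega>)) A)"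

definition stationary_process :: "'a measure \<Rightarrow> (int \<Rightarrow> 'a \<Rightarrow> 'y::topological_space) \<Rightarrow> bool" where
  "stationary_process M Y \<longleftrightarrow>
     (\<forall>h. distr M (PiM UNIV (\<lambda>_. borel)) (\<lambda>\<omega> t. Y (t + h) \<omega>)
        = distr M (PiM UNIV (\<lambda>_. borel)) (\<lambda>\<omega> t. Y t \<omega>))"

text \<open>
  Vectors \<open>(y\<^sub>t, y\<^sub>t\<^sub>-\<^sub>1, \<dots>, y\<^sub>t\<^sub>-\<^sub>p)\<close> are extensional functions on \<open>{0..p}\<close>,
  again indexed by the lag.
\<close>

definition block_space :: "nat \<Rightarrow> (nat \<Rightarrow> 'y::topological_space) measure" where
  "block_space p = PiM {0..p} (\<lambda>_. borel)"

definition block :: "nat \<Rightarrow> (int \<Rightarrow> 'y) \<Rightarrow> int \<Rightarrow> nat \<Rightarrow> 'y" where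
  "block p y t = (\<lambda>i\<in>{0..p}. y (t - int i))"

text \<open>
  The transition kernel of the block chain: from \<open>x\<close> at time \<open>t - 1\<close>, whose entry at lag
  \<open>i\<close> from time \<open>t\<close> is \<open>x (i - 1)\<close>, draw the new observation \<open>z\<close> from \<open>\<kappa>\<close> and shift
  the others by one lag. It uses only entries of \<open>x\<close> because \<open>k \<le> p\<close>.
\<close>

definition block_kernel ::
  "nat \<Rightarrow> ((nat \<Rightarrow> 'y) \<Rightarrow> 'y measure) \<Rightarrow> nat \<Rightarrow> (nat \<Rightarrow> 'y::topological_space) \<Rightarrow> (nat \<Rightarrow> 'y) measure" where
  "block_kernel k \<kappa> p x =
     distr (\<kappa> (\<lambda>i\<in>{1..k}. x (i - 1))) (block_space p)
       (\<lambda>z. \<lambda>i\<in>{0..p}. if i = 0 then z else x (i - 1))"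

text \<open>By stationarity of \<open>Y\<close>, the choice of time \<open>0\<close> is immaterial.\<close>

definition block_law :: "'a measure \<Rightarrow> (int \<Rightarrow> 'a \<Rightarrow> 'y::topological_space) \<Rightarrow> nat \<Rightarrow> (nat \<Rightarrow> 'y) measure" where
  "block_law M Y p = distr M (block_space p) (\<lambda>\<omega>. block p (\<lambda>t. Y t \<omega>) 0)"

definition prediction_functions :: "nat \<Rightarrow> ((nat \<Rightarrow> 'y::topological_space) \<Rightarrow> 'y) set" where
  "prediction_functions p = PiM {1..p} (\<lambda>_. borel) \<rightarrow>\<^sub>M borel"

definition loss_function :: "('y::topological_space \<times> 'y \<Rightarrow> real) \<Rightarrow> bool" where
  "loss_function L \<longleftrightarrow> L \<in> borel \<Otimes>\<^sub>M borel \<rightarrow>\<^sub>M borel \<and> (\<forall>z. 0 \<le> L z \<and> L z \<le> 1)"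

definition prediction_loss ::
  "('y \<times> 'y \<Rightarrow> real) \<Rightarrow> nat \<Rightarrow> ((nat \<Rightarrow> 'y) \<Rightarrow> 'y) \<Rightarrow> (nat \<Rightarrow> 'y) \<Rightarrow> real" where
  "prediction_loss L p g x = L (g (\<lambda>i\<in>{1..p}. x i), x 0)"

definition expected_loss ::
  "('y \<times> 'y \<Rightarrow> real) \<Rightarrow> nat \<Rightarrow> (nat \<Rightarrow> 'y) measure \<Rightarrow> ((nat \<Rightarrow> 'y) \<Rightarrow> 'y) \<Rightarrow> real" where
  "expected_loss L p Q g = (\<integral>x. prediction_loss L p g x \<partial>Q)"

definition validation_loss ::
  "('y \<times> 'y \<Rightarrow> real) \<Rightarrow> nat \<Rightarrow> nat \<Rightarrow> nat \<Rightarrow> ((nat \<Rightarrow> 'y) \<Rightarrow> 'y) \<Rightarrow> (nat \<Rightarrow> nat \<Rightarrow> 'y) \<Rightarrow> real" where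
  "validation_loss L p n m g X = (1 / real m) * (\<Sum>j = n + 1..n + m. prediction_loss L p g (X j))"

end

theory Submission
  imports Defs
begin

text \<open>
  Let \<open>t\<close> be the mixing time and \<open>F = \<plusminus>(f - \<integral>f dQ)\<close>, where \<open>f\<close> is the prediction loss. Each
  application of \<open>K\<^sup>t\<close> halves the oscillation of a function, so for the subchain sampled every
  \<open>t\<close> steps the potential \<open>\<Sum>i<k. K\<^bsup>ti\<^esup> F\<close> is at most \<open>2\<close> and has oscillation at most \<open>2\<close>.
  Hoeffding's lemma, applied once per step of the subchain, bounds the exponential moments of the
  sum of \<open>F\<close> along it. The full sum splits into \<open>t\<close> such subchains, which convexity of \<open>exp\<close>
  recombines, and a Chernoff bound finishes. The bias of the nonstationary start only matters when
  \<open>m \<epsilon>\<^sup>2 / t\<close> is bounded, and there the claim is trivial because the prefactor exceeds \<open>3\<close>.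
\<close>

subsection \<open>Oscillation and total variation\<close>

text \<open>Each value \<open>f x\<close> is the Lebesgue measure of the levels \<open>s\<close> in
  \<open>[0, f x)\<close>, and Tonelli swaps the two integrals. This form turns bounds on events,
  which is what total variation supplies, into bounds on integrals.\<close>

lemma nn_integral_layer_cake:
  assumes "sigma_finite_measure M" and [measurable]: "f \<in> borel_measurable M"
    and nonneg: "\<And>x. x \<in> space M \<Longrightarrow> 0 \<le> f x"
  shows "(\<integral>\<^sup>+x. ennreal (f x) \<partial>M)
    = (\<integral>\<^sup>+s. indicator {0..} s * emeasure M {x \<in> space M. s < f x} \<partial>lborel)"
proof -
  interpret pair_sigma_finite lborel M
    using assms(1) by (simp add: pair_sigma_finite_def lborel.sigma_finite_measure_axioms)
  have "(\<integral>\<^sup>+x. ennreal (f x) \<partial>M)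
      = (\<integral>\<^sup>+x. (\<integral>\<^sup>+s. indicator {0..} s * indicator {x \<in> space M. s < f x} x \<partial>lborel) \<partial>M)"
  proof (rule nn_integral_cong)
    fix x assume x: "x \<in> space M"
    have "(\<integral>\<^sup>+s. indicator {0..} s * indicator {x \<in> space M. s < f x} x \<partial>lborel)
        = (\<integral>\<^sup>+s. indicator {0..<f x} s \<partial>lborel)"
      using x by (intro nn_integral_cong) (auto split: split_indicator)
    also have "\<dots> = ennreal (f x)"
      using nonneg[OF x] by simp
    finally show "ennreal (f x) =
        (\<integral>\<^sup>+s. indicator {0..} s * indicator {x \<in> space M. s < f x} x \<partial>lborel)" by simp
  qed
  also have "\<dots> = (\<integral>\<^sup>+s. (\<integral>\<^sup>+x. indicator {0..} s * indicator {x \<in> space M. s < f x} x \<partial>M) \<partial>lborel)"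
    by (rule Fubini') measurable
  also have "\<dots> = (\<integral>\<^sup>+s. indicator {0..} s * emeasure M {x \<in> space M. s < f x} \<partial>lborel)"
  proof (rule nn_integral_cong)
    fix s :: real
    have [measurable]: "{x \<in> space M. s < f x} \<in> sets M" by measurable
    show "(\<integral>\<^sup>+x. indicator {0..} s * indicator {x \<in> space M. s < f x} x \<partial>M)
        = indicator {0..} s * emeasure M {x \<in> space M. s < f x}"
      by (rule nn_integral_cmult_indicator) measurable
  qed
  finally show ?thesis .
qed

lemma measure_diff_le_tv_dist:
  assumes "prob_space \<mu>" "prob_space \<nu>" "A \<in> sets \<mu>"
  shows "\<bar>measure \<mu> A - measure \<nu> A\<bar> \<le> tv_dist \<mu> \<nu>"
  unfolding tv_dist_def
proof (rule cSUP_upper[OF assms(3)])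
  have "\<bar>measure \<mu> B - measure \<nu> B\<bar> \<le> 1" for B
    using prob_space.prob_le_1[OF assms(1), of B] prob_space.prob_le_1[OF assms(2), of B]
      measure_nonneg[of \<mu> B] measure_nonneg[of \<nu> B]
    by linarith
  then show "bdd_above ((\<lambda>A. \<bar>measure \<mu> A - measure \<nu> A\<bar>) ` sets \<mu>)"
    by (intro bdd_aboveI) auto
qed

lemma tv_dist_le_1:
  assumes "prob_space \<mu>" "prob_space \<nu>"
  shows "tv_dist \<mu> \<nu> \<le> 1"
  unfolding tv_dist_def
proof (rule cSUP_least)
  show "\<bar>measure \<mu> B - measure \<nu> B\<bar> \<le> 1" for B
    using prob_space.prob_le_1[OF assms(1), of B] prob_space.prob_le_1[OF assms(2), of B]
      measure_nonneg[of \<mu> B] measure_nonneg[of \<nu> B]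
    by linarith
qed auto

text \<open>Oscillation takes the place of the sup norm because it ignores additive constants and is
  the quantity that the kernel contracts. Measurability is bundled in so that this one predicate
  gives integrability under every probability measure on \<open>S\<close>.\<close>

definition oscillation_le :: "'s measure \<Rightarrow> real \<Rightarrow> ('s \<Rightarrow> real) \<Rightarrow> bool" where
  "oscillation_le S c G \<longleftrightarrow>
     G \<in> borel_measurable S \<and> (\<forall>x\<in>space S. \<forall>y\<in>space S. G x - G y \<le> c)"

lemma oscillation_le_measurable: "oscillation_le S c G \<Longrightarrow> G \<in> borel_measurable S"
  by (simp add: oscillation_le_def)

lemma oscillation_leD: "oscillation_le S c G \<Longrightarrow> x \<in> space S \<Longrightarrow> y \<in> space S \<Longrightarrow> G x - G y \<le> c"
  by (simp add: oscillation_le_def)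

text \<open>The lower endpoint is the infimum of \<open>G\<close>; it exists because
  \<open>G x - c\<close> is a lower bound for any point \<open>x\<close>.\<close>

lemma oscillation_le_interval:
  assumes G: "oscillation_le S c G"
  obtains lo where "\<And>x. x \<in> space S \<Longrightarrow> lo \<le> G x" "\<And>x. x \<in> space S \<Longrightarrow> G x \<le> lo + c"
proof
  show "(INF x\<in>space S. G x) \<le> G x" if "x \<in> space S" for x
    using that oscillation_leD[OF G that]
    by (intro cINF_lower bdd_belowI[of _ "G x - c"]) (auto simp: algebra_simps)
  show "G x \<le> (INF x\<in>space S. G x) + c" if "x \<in> space S" for x
  proof -
    have "G x - c \<le> (INF x\<in>space S. G x)"
      using that oscillation_leD[OF G that] by (intro cINF_greatest) (auto simp: algebra_simps)
    then show ?thesis by simp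
  qed
qed

lemma oscillation_le_bounded:
  assumes "oscillation_le S c G"
  obtains B where "\<And>x. x \<in> space S \<Longrightarrow> \<bar>G x\<bar> \<le> B"
proof -
  obtain lo where "\<And>x. x \<in> space S \<Longrightarrow> lo \<le> G x" "\<And>x. x \<in> space S \<Longrightarrow> G x \<le> lo + c"
    using oscillation_le_interval[OF assms] by blast
  then have "\<bar>G x\<bar> \<le> \<bar>lo\<bar> + \<bar>lo + c\<bar>" if "x \<in> space S" for x
    using that by fastforce
  then show ?thesis by (rule that)
qed

lemma oscillation_le_integrable:
  assumes G: "oscillation_le S c G" and "prob_space \<mu>" and S: "sets \<mu> = sets S"
  shows "integrable \<mu> G"
proof -
  interpret prob_space \<mu> by fact
  obtain B where B: "\<And>x. x \<in> space S \<Longrightarrow> \<bar>G x\<bar> \<le> B"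
    using oscillation_le_bounded[OF G] by blast
  show ?thesis
    by (rule integrable_const_bound[where B=B])
      (use B S G in \<open>auto simp: sets_eq_imp_space_eq[OF S] oscillation_le_def cong: measurable_cong_sets\<close>)
qed

text \<open>After the shift to \<open>H = G - lo\<close> with values in \<open>[0, c]\<close>, the
  layer-cake formula expresses both integrals through the probabilities of \<open>{H > s}\<close>.
  These differ by at most the total variation distance, and only levels in \<open>[0, c]\<close>
  contribute, so the factor is \<open>c\<close> and not \<open>2 * c\<close>.\<close>

lemma integral_diff_le_tv_dist:
  assumes G: "oscillation_le S c G"
    and "prob_space \<mu>" "prob_space \<nu>" and S: "sets \<mu> = sets S" "sets \<nu> = sets S"
  shows "(\<integral>x. G x \<partial>\<mu>) - (\<integral>x. G x \<partial>\<nu>) \<le> c * tv_dist \<mu> \<nu>"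
proof -
  interpret \<mu>: prob_space \<mu> by fact
  interpret \<nu>: prob_space \<nu> by fact
  have sp: "space \<mu> = space S" "space \<nu> = space S"
    using S by (auto dest: sets_eq_imp_space_eq)
  obtain z where z: "z \<in> space S"
    using \<mu>.not_empty sp by auto
  have c: "0 \<le> c"
    using oscillation_leD[OF G z z] by simp
  have [measurable]: "G \<in> borel_measurable S" "G \<in> borel_measurable \<mu>" "G \<in> borel_measurable \<nu>"
    using oscillation_le_measurable[OF G] S by (auto cong: measurable_cong_sets)
  obtain lo where lo: "\<And>x. x \<in> space S \<Longrightarrow> lo \<le> G x" "\<And>x. x \<in> space S \<Longrightarrow> G x \<le> lo + c"
    using oscillation_le_interval[OF G] by blast
  define H where "H = (\<lambda>x. G x - lo)"
  have [measurable]: "H \<in> borel_measurable S" "H \<in> borel_measurable \<mu>" "H \<in> borel_measurable \<nu>"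
    unfolding H_def by measurable
  have H0: "0 \<le> H x" and Hc: "H x \<le> c" if "x \<in> space S" for x
    using lo that by (auto simp: H_def algebra_simps)
  have int: "integrable \<mu> G" "integrable \<nu> G"
    using oscillation_le_integrable[OF G] assms by auto
  have AE: "AE x in \<mu>. 0 \<le> H x" "AE x in \<nu>. 0 \<le> H x"
    using H0 sp by auto
  have *: "(\<integral>\<^sup>+x. ennreal (H x) \<partial>\<mu>) = ennreal ((\<integral>x. G x \<partial>\<mu>) - lo)"
       "(\<integral>\<^sup>+x. ennreal (H x) \<partial>\<nu>) = ennreal ((\<integral>x. G x \<partial>\<nu>) - lo)"
    using int AE nn_integral_eq_integral[of \<mu> H] nn_integral_eq_integral[of \<nu> H]
    by (simp_all add: H_def \<mu>.prob_space \<nu>.prob_space)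
  \<comment> \<open>Nonnegativity allows the final inequality in \<open>ennreal\<close> to be read
    back as one between reals.\<close>
  have pos: "0 \<le> (\<integral>x. G x \<partial>\<nu>) - lo"
  proof -
    have "0 \<le> (\<integral>x. H x \<partial>\<nu>)"
      using H0 sp by (intro integral_nonneg_AE) auto
    then show ?thesis using int by (simp add: H_def \<nu>.prob_space)
  qed
  define \<tau> where "\<tau> = tv_dist \<mu> \<nu>"
  have \<tau>: "0 \<le> \<tau>"
    using measure_diff_le_tv_dist[OF assms(2,3), of "{}"] by (simp add: \<tau>_def)
  have "(\<integral>\<^sup>+x. ennreal (H x) \<partial>\<mu>)
      = (\<integral>\<^sup>+s. indicator {0..} s * emeasure \<mu> {x \<in> space \<mu>. s < H x} \<partial>lborel)"
    by (rule nn_integral_layer_cake) (use H0 sp in \<open>auto intro: \<mu>.sigma_finite_measure_axioms\<close>)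
  also have "\<dots> \<le> (\<integral>\<^sup>+s. indicator {0..} s * emeasure \<nu> {x \<in> space \<nu>. s < H x}
      + ennreal \<tau> * indicator {0..c} s \<partial>lborel)"
  proof (rule nn_integral_mono)
    fix s :: real
    show "indicator {0..} s * emeasure \<mu> {x \<in> space \<mu>. s < H x}
      \<le> indicator {0..} s * emeasure \<nu> {x \<in> space \<nu>. s < H x} + ennreal \<tau> * indicator {0..c} s"
    proof (cases "0 \<le> s \<and> s \<le> c")
      case True
      have "measure \<mu> {x \<in> space \<mu>. s < H x} \<le> measure \<nu> {x \<in> space \<nu>. s < H x} + \<tau>"
        using measure_diff_le_tv_dist[OF assms(2,3), of "{x \<in> space \<mu>. s < H x}"]
        unfolding sp \<tau>_def S by simp
      then have "ennreal (measure \<mu> {x \<in> space \<mu>. s < H x})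
          \<le> ennreal (measure \<nu> {x \<in> space \<nu>. s < H x}) + ennreal \<tau>"
        using \<tau> by (simp flip: ennreal_plus)
      then show ?thesis
        using True by (simp add: \<mu>.emeasure_eq_measure \<nu>.emeasure_eq_measure)
    next
      case False
      \<comment> \<open>Above \<open>c\<close> the superlevel set is empty; below \<open>0\<close>
        the indicator vanishes.\<close>
      have "{x \<in> space \<mu>. s < H x} = {}" if "c < s"
        using Hc sp that by force
      then have "emeasure \<mu> {x \<in> space \<mu>. s < H x} = 0" if "c < s"
        using that by (metis emeasure_empty)
      then show ?thesis
        using False by (cases "0 \<le> s") (simp_all add: not_le)
    qed
  qed
  also have "\<dots> = (\<integral>\<^sup>+s. indicator {0..} s * emeasure \<nu> {x \<in> space \<nu>. s < H x} \<partial>lborel)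
      + (\<integral>\<^sup>+s. ennreal \<tau> * indicator {0..c} s \<partial>lborel)"
    by (rule nn_integral_add) measurable
  also have "(\<integral>\<^sup>+s. indicator {0..} s * emeasure \<nu> {x \<in> space \<nu>. s < H x} \<partial>lborel)
      = (\<integral>\<^sup>+x. ennreal (H x) \<partial>\<nu>)"
    by (rule nn_integral_layer_cake[symmetric])
      (use H0 sp in \<open>auto intro: \<nu>.sigma_finite_measure_axioms\<close>)
  also have "(\<integral>\<^sup>+s. ennreal \<tau> * indicator {0..c} s \<partial>lborel) = ennreal (c * \<tau>)"
    using c \<tau> by (simp add: nn_integral_cmult_indicator ennreal_mult mult.commute)
  finally have "ennreal ((\<integral>x. G x \<partial>\<mu>) - lo) \<le> ennreal ((\<integral>x. G x \<partial>\<nu>) - lo) + ennreal (c * \<tau>)"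
    by (simp add: *)
  then have "(\<integral>x. G x \<partial>\<mu>) - lo \<le> (\<integral>x. G x \<partial>\<nu>) - lo + c * \<tau>"
    using pos c \<tau> by (simp flip: ennreal_plus add: ennreal_le_iff)
  then show ?thesis by (simp add: \<tau>_def)
qed

lemma tv_dist_commute:
  assumes "sets \<mu> = sets \<nu>"
  shows "tv_dist \<mu> \<nu> = tv_dist \<nu> \<mu>"
  using assms by (simp add: tv_dist_def abs_minus_commute)

lemma integral_abs_diff_le_tv_dist:
  assumes "oscillation_le S c G"
    and "prob_space \<mu>" "prob_space \<nu>" "sets \<mu> = sets S" "sets \<nu> = sets S"
  shows "\<bar>(\<integral>x. G x \<partial>\<mu>) - (\<integral>x. G x \<partial>\<nu>)\<bar> \<le> c * tv_dist \<mu> \<nu>"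
  using integral_diff_le_tv_dist[OF assms] tv_dist_commute[of \<mu> \<nu>]
    integral_diff_le_tv_dist[OF assms(1,3,2,5,4)] assms by auto

text \<open>Total variation is at most one. In this form the two measures need not be close, so it
  serves for arbitrary starting points and for point masses.\<close>

lemma integral_diff_le_oscillation:
  assumes G: "oscillation_le S c G"
    and \<mu>\<nu>: "prob_space \<mu>" "prob_space \<nu>" and S: "sets \<mu> = sets S" "sets \<nu> = sets S"
  shows "(\<integral>x. G x \<partial>\<mu>) - (\<integral>x. G x \<partial>\<nu>) \<le> c"
proof -
  obtain z where "z \<in> space S"
    using prob_space.not_empty[OF \<mu>\<nu>(1)] sets_eq_imp_space_eq[OF S(1)] by auto
  then have "0 \<le> c" using oscillation_leD[OF G, of z z] by simp
  then have "c * tv_dist \<mu> \<nu> \<le> c * 1"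
    using tv_dist_le_1[OF \<mu>\<nu>] by (intro mult_left_mono)
  then show ?thesis using integral_diff_le_tv_dist[OF assms] by simp
qed

subsection \<open>Powers of a Markov kernel\<close>

locale markov_kernel =
  fixes S :: "'s measure" and K :: "'s \<Rightarrow> 's measure"
  assumes kernel [measurable]: "K \<in> S \<rightarrow>\<^sub>M prob_algebra S"
begin

lemma kernel_power_0_eq: "kernel_power S K 0 = return S"
  by (rule ext) simp

lemma measurable_kernel_power [measurable]: "kernel_power S K n \<in> S \<rightarrow>\<^sub>M prob_algebra S"
proof (induction n)
  case 0
  show ?case unfolding kernel_power_0_eq by measurable
next
  case (Suc n)
  have "(\<lambda>x. kernel_power S K n x \<bind> K) \<in> S \<rightarrow>\<^sub>M prob_algebra S"
    by (rule measurable_bind_prob_space[OF Suc kernel])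
  then show ?case by (simp cong: measurable_cong)
qed

lemma prob_space_kernel_power: "x \<in> space S \<Longrightarrow> prob_space (kernel_power S K n x)"
  using measurable_space[OF measurable_kernel_power] by (auto simp: space_prob_algebra)

lemma sets_kernel_power: "x \<in> space S \<Longrightarrow> sets (kernel_power S K n x) = sets S"
  using measurable_space[OF measurable_kernel_power] by (auto simp: space_prob_algebra)

lemma space_kernel_power: "x \<in> space S \<Longrightarrow> space (kernel_power S K n x) = space S"
  using sets_kernel_power by (rule sets_eq_imp_space_eq)

lemma measurable_from_kernel_power:
  assumes "x \<in> space S"
  shows "measurable (kernel_power S K n x) N = measurable S N"
  by (rule measurable_cong_sets) (simp_all add: sets_kernel_power[OF assms])

lemma kernel_power_subprob: "kernel_power S K n \<in> S \<rightarrow>\<^sub>M subprob_algebra S"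
  by (rule measurable_prob_algebraD) measurable

lemma kernel_subprob: "K \<in> S \<rightarrow>\<^sub>M subprob_algebra S"
  by (rule measurable_prob_algebraD) measurable

lemma kernel_power_1: "x \<in> space S \<Longrightarrow> kernel_power S K (Suc 0) x = K x"
  by (simp add: bind_return[OF kernel_subprob])

text \<open>The Chapman-Kolmogorov equation. Powers are defined by appending \<open>K\<close> on the
  right, so induction on \<open>n\<close> reduces it to associativity of
  \<open>bind\<close>.\<close>

lemma kernel_power_add:
  assumes "x \<in> space S"
  shows "kernel_power S K (m + n) x = kernel_power S K m x \<bind> kernel_power S K n"
proof (induction n)
  case 0
  show ?case
    unfolding kernel_power_0_eq by (simp add: bind_return'' sets_kernel_power[OF assms])
next
  case (Suc n)
  have "kernel_power S K (m + Suc n) x = (kernel_power S K m x \<bind> kernel_power S K n) \<bind> K"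
    using Suc by simp
  also have "\<dots> = kernel_power S K m x \<bind> (\<lambda>y. kernel_power S K n y \<bind> K)"
    by (rule bind_assoc[where N=S and R=S])
      (simp_all add: measurable_from_kernel_power[OF assms] kernel_power_subprob kernel_subprob)
  finally show ?case by simp
qed

lemma nn_integral_kernel_power_add:
  assumes "x \<in> space S" and "u \<in> borel_measurable S"
  shows "(\<integral>\<^sup>+z. u z \<partial>kernel_power S K (m + n) x)
    = (\<integral>\<^sup>+y. \<integral>\<^sup>+z. u z \<partial>kernel_power S K n y \<partial>kernel_power S K m x)"
  unfolding kernel_power_add[OF assms(1)]
  by (rule nn_integral_bind[where B=S])
    (simp_all add: assms measurable_from_kernel_power kernel_power_subprob)

definition markov_op :: "nat \<Rightarrow> ('s \<Rightarrow> real) \<Rightarrow> 's \<Rightarrow> real" where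
  "markov_op n G x = (\<integral>z. G z \<partial>kernel_power S K n x)"

lemma markov_op_0: "G \<in> borel_measurable S \<Longrightarrow> x \<in> space S \<Longrightarrow> markov_op 0 G x = G x"
  by (simp add: markov_op_def integral_return)

lemma oscillation_le_markov_op:
  assumes "oscillation_le S c G"
  shows "oscillation_le S c (markov_op n G)"
  unfolding oscillation_le_def
proof (intro conjI ballI)
  show "markov_op n G \<in> borel_measurable S"
    unfolding markov_op_def
    by (rule measurable_compose[OF kernel_power_subprob integral_measurable_subprob_algebra])
      (rule oscillation_le_measurable[OF assms])
  show "markov_op n G x - markov_op n G y \<le> c" if "x \<in> space S" "y \<in> space S" for x y
    unfolding markov_op_def
    by (rule integral_diff_le_oscillation[OF assms])
      (simp_all add: that prob_space_kernel_power sets_kernel_power)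
qed

text \<open>The semigroup law on functions, from Chapman-Kolmogorov. The bound on \<open>G\<close>
  and the unit mass of the kernels are what \<open>integral_bind\<close> asks for.\<close>

lemma markov_op_add:
  assumes G: "oscillation_le S c G" and x: "x \<in> space S"
  shows "markov_op (m + n) G x = markov_op m (markov_op n G) x"
proof -
  interpret prob_space "kernel_power S K m x" by (rule prob_space_kernel_power[OF x])
  obtain B where B: "\<And>x. x \<in> space S \<Longrightarrow> \<bar>G x\<bar> \<le> B"
    using oscillation_le_bounded[OF G] by blast
  have "AE y in kernel_power S K m x. emeasure (kernel_power S K n y) (space (kernel_power S K n y)) \<le> ennreal 1"
    by (rule AE_I2) (simp add: space_kernel_power[OF x] prob_space.emeasure_space_1[OF prob_space_kernel_power])
  then show ?thesis
    unfolding markov_op_def kernel_power_add[OF x]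
    by (intro integral_bind[where K=S and B=B and B'=1])
      (auto simp: B measurable_from_kernel_power[OF x] kernel_power_subprob
        intro: oscillation_le_measurable[OF G] finite_measure_axioms)
qed

end

section \<open>Invariance of the limit law and contraction at the mixing time\<close>

locale ergodic_kernel = markov_kernel S K
  for S :: "'s measure" and K +
  fixes Q :: "'s measure"
  assumes prob_Q: "prob_space Q" and sets_Q: "sets Q = sets S"
    and ergodic: "uniformly_ergodic S K Q"
begin

lemma tv_dist_le_worst_tv:
  assumes "x \<in> space S"
  shows "tv_dist (kernel_power S K n x) Q \<le> worst_tv S K Q n"
  unfolding worst_tv_def
  by (rule cSUP_upper[OF assms])
    (auto intro!: bdd_aboveI[of _ 1] tv_dist_le_1 prob_space_kernel_power prob_Q)

lemma markov_op_diff_le: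
  assumes G: "oscillation_le S c G" and x: "x \<in> space S"
  shows "\<bar>markov_op n G x - (\<integral>z. G z \<partial>Q)\<bar> \<le> c * worst_tv S K Q n"
proof -
  have "0 \<le> c" using oscillation_leD[OF G x x] by simp
  then have "c * tv_dist (kernel_power S K n x) Q \<le> c * worst_tv S K Q n"
    by (intro mult_left_mono tv_dist_le_worst_tv[OF x])
  moreover have "\<bar>markov_op n G x - (\<integral>z. G z \<partial>Q)\<bar> \<le> c * tv_dist (kernel_power S K n x) Q"
    unfolding markov_op_def
    by (rule integral_abs_diff_le_tv_dist[OF G])
      (simp_all add: x prob_space_kernel_power sets_kernel_power prob_Q sets_Q)
  ultimately show ?thesis by simp
qed

lemma worst_tv_nonneg: "0 \<le> worst_tv S K Q n"
proof -
  obtain x where x: "x \<in> space S"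
    using prob_space.not_empty[OF prob_Q] sets_eq_imp_space_eq[OF sets_Q] by auto
  have "0 \<le> tv_dist (kernel_power S K n x) Q"
    using measure_diff_le_tv_dist[OF prob_space_kernel_power[OF x] prob_Q, of "{}"] by simp
  then show ?thesis using tv_dist_le_worst_tv[OF x, of n] by simp
qed

lemma worst_tv_tendsto_0: "worst_tv S K Q \<longlonglongrightarrow> 0"
proof -
  obtain C \<rho> where C: "0 < C" "0 < \<rho>" "\<rho> < 1" "\<And>n. worst_tv S K Q n \<le> C * \<rho> ^ n"
    using ergodic unfolding uniformly_ergodic_def by auto
  have "(\<lambda>n. C * \<rho> ^ n) \<longlonglongrightarrow> C * 0"
    using C by (intro tendsto_mult tendsto_const LIMSEQ_realpow_zero) auto
  then have "(\<lambda>n. C * \<rho> ^ n) \<longlonglongrightarrow> 0" by simp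
  then show ?thesis
    by (rule Lim_null_comparison[rotated]) (use C(4) worst_tv_nonneg in auto)
qed

text \<open>The geometric bound brings \<open>worst_tv\<close> below \<open>1 / 4\<close> at some
  positive time; such a witness is what gives the \<open>LEAST\<close> in \<open>mixing_time\<close>
  its meaning.\<close>

lemma mixing_time_pos: "1 \<le> mixing_time S K Q"
  and worst_tv_mixing_time: "worst_tv S K Q (mixing_time S K Q) \<le> 1 / 4"
proof -
  have "\<forall>\<^sub>F n in sequentially. worst_tv S K Q n < 1 / 4"
    using worst_tv_tendsto_0 by (rule order_tendstoD) simp
  then have "\<forall>\<^sub>F n in sequentially. 1 \<le> n \<and> worst_tv S K Q n \<le> 1 / 4"
    using eventually_ge_at_top[of 1] by eventually_elim auto
  then obtain n where "1 \<le> n \<and> worst_tv S K Q n \<le> 1 / 4"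
    by (auto dest!: eventually_happens)
  from LeastI[of "\<lambda>t. 1 \<le> t \<and> worst_tv S K Q t \<le> 1 / 4", OF this]
  show "1 \<le> mixing_time S K Q" "worst_tv S K Q (mixing_time S K Q) \<le> 1 / 4"
    by (simp_all add: mixing_time_def)
qed

text \<open>Invariance of \<open>Q\<close> follows from convergence to \<open>Q\<close>: as
  \<open>n\<close> grows, \<open>markov_op (n + k) G x\<close> tends to the \<open>Q\<close>-mean of
  \<open>G\<close>, and read as \<open>markov_op n (markov_op k G) x\<close> it tends to the
  \<open>Q\<close>-mean of \<open>markov_op k G\<close>. Limits are unique.\<close>

lemma integral_markov_op:
  assumes G: "oscillation_le S c G"
  shows "(\<integral>x. markov_op k G x \<partial>Q) = (\<integral>x. G x \<partial>Q)"
proof -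
  obtain x where x: "x \<in> space S"
    using prob_space.not_empty[OF prob_Q] sets_eq_imp_space_eq[OF sets_Q] by auto
  have lim: "(\<lambda>n. markov_op n H x) \<longlonglongrightarrow> (\<integral>z. H z \<partial>Q)" if H: "oscillation_le S c H" for H
  proof (rule LIM_zero_cancel, rule Lim_null_comparison)
    have "(\<lambda>n. c * worst_tv S K Q n) \<longlonglongrightarrow> c * 0"
      by (intro tendsto_intros worst_tv_tendsto_0)
    then show "(\<lambda>n. c * worst_tv S K Q n) \<longlonglongrightarrow> 0" by simp
  qed (use markov_op_diff_le[OF H x] in auto)
  have "(\<lambda>n. markov_op n (markov_op k G) x) \<longlonglongrightarrow> (\<integral>z. G z \<partial>Q)"
    using LIMSEQ_ignore_initial_segment[OF lim[OF G], of k] markov_op_add[OF G x] by simp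
  then show ?thesis
    using lim[OF oscillation_le_markov_op[OF G]] LIMSEQ_unique by blast
qed

text \<open>At the mixing time the values at \<open>x\<close> and at \<open>y\<close> both lie
  within \<open>c / 4\<close> of the \<open>Q\<close>-mean of \<open>G\<close>, hence within
  \<open>c / 2\<close> of each other.\<close>

lemma oscillation_le_markov_op_mixing_time:
  assumes G: "oscillation_le S c G"
  shows "oscillation_le S (c / 2) (markov_op (mixing_time S K Q) G)"
  unfolding oscillation_le_def
proof (intro conjI ballI)
  show "markov_op (mixing_time S K Q) G \<in> borel_measurable S"
    by (rule oscillation_le_measurable[OF oscillation_le_markov_op[OF G]])
  fix x y assume xy: "x \<in> space S" "y \<in> space S"
  have "0 \<le> c" using oscillation_leD[OF G xy(1) xy(1)] by simp
  then have "c * worst_tv S K Q (mixing_time S K Q) \<le> c / 4"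
    using mult_left_mono[OF worst_tv_mixing_time] by fastforce
  then show "markov_op (mixing_time S K Q) G x - markov_op (mixing_time S K Q) G y \<le> c / 2"
    using markov_op_diff_le[OF G xy(1), of "mixing_time S K Q"]
      markov_op_diff_le[OF G xy(2), of "mixing_time S K Q"] by linarith
qed

end

subsection \<open>Integrals along paths\<close>

context markov_kernel
begin

lemma space_kernel: "x \<in> space S \<Longrightarrow> space (K x) = space S"
  using space_kernel_power[of x "Suc 0"] by (simp add: kernel_power_1 del: kernel_power.simps)

lemma sets_kernel_eq: "x \<in> space S \<Longrightarrow> sets (K x) = sets S"
  using sets_kernel_power[of x "Suc 0"] by (simp add: kernel_power_1 del: kernel_power.simps)

lemma prob_space_kernel: "x \<in> space S \<Longrightarrow> prob_space (K x)"
  using prob_space_kernel_power[of x "Suc 0"] by (simp add: kernel_power_1 del: kernel_power.simps)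

text \<open>The expectation of the product of \<open>\<phi> j (X (Suc j))\<close> over
  \<open>j < m\<close>, times \<open>\<psi> (X m)\<close>, for the chain with
  \<open>X 0 = x\<close>. The starting point carries no factor \<open>\<phi>\<close>. Values in
  \<open>ennreal\<close> avoid integrability conditions.\<close>

primrec path_integral ::
  "(nat \<Rightarrow> 's \<Rightarrow> ennreal) \<Rightarrow> nat \<Rightarrow> ('s \<Rightarrow> ennreal) \<Rightarrow> 's \<Rightarrow> ennreal" where
  "path_integral \<phi> 0 \<psi> x = \<psi> x"
| "path_integral \<phi> (Suc m) \<psi> x = (\<integral>\<^sup>+z. \<phi> 0 z * path_integral (\<lambda>j. \<phi> (Suc j)) m \<psi> z \<partial>K x)"

lemma measurable_nn_integral_kernel:
  "u \<in> borel_measurable S \<Longrightarrow> (\<lambda>x. \<integral>\<^sup>+z. u z \<partial>K x) \<in> borel_measurable S"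
  by (rule measurable_compose[OF kernel_subprob nn_integral_measurable_subprob_algebra])

lemma measurable_path_integral:
  assumes "\<And>j. \<phi> j \<in> borel_measurable S" "\<psi> \<in> borel_measurable S"
  shows "path_integral \<phi> m \<psi> \<in> borel_measurable S"
  using assms(1)
proof (induction m arbitrary: \<phi>)
  case 0
  have "path_integral \<phi> 0 \<psi> = \<psi>" by (rule ext) simp
  then show ?case using assms(2) by simp
next
  case (Suc m)
  have [measurable]: "path_integral (\<lambda>j. \<phi> (Suc j)) m \<psi> \<in> borel_measurable S"
    "\<phi> 0 \<in> borel_measurable S"
    using Suc by auto
  have "(\<lambda>x. \<integral>\<^sup>+z. \<phi> 0 z * path_integral (\<lambda>j. \<phi> (Suc j)) m \<psi> z \<partial>K x) \<in> borel_measurable S"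
    by (rule measurable_nn_integral_kernel) measurable
  then show ?case by (simp cong: measurable_cong)
qed

text \<open>Splits off the last step instead of the first: \<open>path_integral\<close> recurses at
  the front of the path, whereas \<open>chain_law\<close> grows at its end.\<close>

lemma path_integral_append:
  "x \<in> space S \<Longrightarrow>
    path_integral \<phi> (Suc m) \<psi> x = path_integral \<phi> m (\<lambda>y. \<integral>\<^sup>+z. \<phi> m z * \<psi> z \<partial>K y) x"
proof (induction m arbitrary: \<phi> x)
  case (Suc m)
  have "path_integral \<phi> (Suc (Suc m)) \<psi> x
      = (\<integral>\<^sup>+z. \<phi> 0 z * path_integral (\<lambda>j. \<phi> (Suc j)) (Suc m) \<psi> z \<partial>K x)"
    by (rule path_integral.simps(2))
  also have "\<dots> = (\<integral>\<^sup>+z. \<phi> 0 z * path_integral (\<lambda>j. \<phi> (Suc j)) m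
      (\<lambda>y. \<integral>\<^sup>+z. \<phi> (Suc m) z * \<psi> z \<partial>K y) z \<partial>K x)"
    by (rule nn_integral_cong) (use Suc in \<open>simp add: space_kernel del: path_integral.simps\<close>)
  finally show ?case by simp
qed simp

lemma path_integral_one:
  "x \<in> space S \<Longrightarrow> (\<And>j. j < m \<Longrightarrow> \<phi> j = (\<lambda>_. 1)) \<Longrightarrow> path_integral \<phi> m (\<lambda>_. 1) x = 1"
proof (induction m arbitrary: \<phi> x)
  case (Suc m)
  have "path_integral \<phi> (Suc m) (\<lambda>_. 1) x = (\<integral>\<^sup>+z. 1 \<partial>K x)"
    unfolding path_integral.simps
    by (rule nn_integral_cong) (use Suc in \<open>simp add: space_kernel\<close>)
  then show ?case
    using prob_space.emeasure_space_1[OF prob_space_kernel[OF Suc.prems(1)]] by simp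
qed simp

text \<open>As long as the factors are one, the intermediate states are integrated out, and
  Chapman-Kolmogorov merges \<open>Suc d\<close> steps into one step of the power kernel. The factor
  \<open>\<phi> d\<close> belongs to the state reached after these \<open>Suc d\<close>
  steps.\<close>

lemma path_integral_skip:
  assumes "\<And>j. \<phi> j \<in> borel_measurable S" "\<psi> \<in> borel_measurable S"
    and "x \<in> space S" and "\<And>j. j < d \<Longrightarrow> \<phi> j = (\<lambda>_. 1)"
  shows "path_integral \<phi> (Suc d + m) \<psi> x
    = (\<integral>\<^sup>+z. \<phi> d z * path_integral (\<lambda>j. \<phi> (Suc d + j)) m \<psi> z \<partial>kernel_power S K (Suc d) x)"
  using assms(1,3,4)
proof (induction d arbitrary: \<phi> x)
  case 0
  then show ?case by (simp add: kernel_power_1 del: kernel_power.simps)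
next
  case (Suc d)
  let ?u = "\<lambda>w. \<phi> (Suc d) w * path_integral (\<lambda>j. \<phi> (Suc (Suc d) + j)) m \<psi> w"
  have [measurable]: "path_integral (\<lambda>j. \<phi> (Suc (Suc d) + j)) m \<psi> \<in> borel_measurable S"
    "\<phi> (Suc d) \<in> borel_measurable S"
    using Suc.prems(1) assms(2) measurable_path_integral by auto
  have "path_integral \<phi> (Suc (Suc d) + m) \<psi> x
      = (\<integral>\<^sup>+z. \<phi> 0 z * path_integral (\<lambda>j. \<phi> (Suc j)) (Suc d + m) \<psi> z \<partial>K x)"
    using path_integral.simps(2)[of \<phi> "Suc d + m"] by simp
  also have "\<dots> = (\<integral>\<^sup>+z. \<integral>\<^sup>+w. ?u w \<partial>kernel_power S K (Suc d) z \<partial>K x)"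
  proof (rule nn_integral_cong)
    fix z assume "z \<in> space (K x)"
    then have "z \<in> space S" using space_kernel[OF Suc.prems(2)] by simp
    then have "path_integral (\<lambda>j. \<phi> (Suc j)) (Suc d + m) \<psi> z
        = (\<integral>\<^sup>+w. ?u w \<partial>kernel_power S K (Suc d) z)"
      using Suc.IH[of "\<lambda>j. \<phi> (Suc j)" z] Suc.prems by simp
    then show "\<phi> 0 z * path_integral (\<lambda>j. \<phi> (Suc j)) (Suc d + m) \<psi> z
        = (\<integral>\<^sup>+w. ?u w \<partial>kernel_power S K (Suc d) z)"
      using Suc.prems(3)[of 0] by simp
  qed
  also have "\<dots> = (\<integral>\<^sup>+w. ?u w \<partial>kernel_power S K (Suc 0 + Suc d) x)"
    unfolding kernel_power_1[OF Suc.prems(2), symmetric]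
    by (rule nn_integral_kernel_power_add[OF Suc.prems(2), symmetric]) measurable
  finally show ?case by simp
qed

section \<open>The law of the path and expectations of products under it\<close>

lemma measurable_chain_step:
  "(\<lambda>X. distr (K (X (n + m))) (PiM {n..n + Suc m} (\<lambda>_. S)) (\<lambda>z. X(n + Suc m := z)))
    \<in> PiM {n..n + m} (\<lambda>_. S) \<rightarrow>\<^sub>M prob_algebra (PiM {n..n + Suc m} (\<lambda>_. S))"
proof (rule measurable_distr_prob_space2)
  show "(\<lambda>X. K (X (n + m))) \<in> PiM {n..n + m} (\<lambda>_. S) \<rightarrow>\<^sub>M prob_algebra S"
    by (rule measurable_compose[OF measurable_component_singleton[of _ _ "\<lambda>_. S"] kernel]) simp
  show "(\<lambda>(X, z). X(n + Suc m := z))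
      \<in> PiM {n..n + m} (\<lambda>_. S) \<Otimes>\<^sub>M S \<rightarrow>\<^sub>M PiM {n..n + Suc m} (\<lambda>_. S)"
    using measurable_add_dim[of "n + Suc m" "{n..n + m}" "\<lambda>_. S"]
    by (simp add: atLeastAtMostSuc_conv)
qed

lemma chain_law_in_prob_algebra:
  assumes "x \<in> space S"
  shows "chain_law S K n x m \<in> space (prob_algebra (PiM {n..n + m} (\<lambda>_. S)))"
proof (induction m)
  case 0
  have "(\<lambda>j\<in>{n..n}. x) \<in> space (PiM {n..n} (\<lambda>_. S))"
    using assms by (auto simp: space_PiM)
  then show ?case
    using prob_space_return by (fastforce simp: space_prob_algebra)
next
  case (Suc m)
  show ?case
    using prob_space_bind'[OF Suc measurable_chain_step] sets_bind'[OF Suc measurable_chain_step]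
    by (simp add: space_prob_algebra)
qed

lemma prob_space_chain_law: "x \<in> space S \<Longrightarrow> prob_space (chain_law S K n x m)"
  and sets_chain_law: "x \<in> space S \<Longrightarrow> sets (chain_law S K n x m) = sets (PiM {n..n + m} (\<lambda>_. S))"
  using chain_law_in_prob_algebra by (auto simp: space_prob_algebra)

lemma measurable_from_chain_law:
  "x \<in> space S \<Longrightarrow> measurable (chain_law S K n x m) N = measurable (PiM {n..n + m} (\<lambda>_. S)) N"
  by (rule measurable_cong_sets) (simp_all add: sets_chain_law)

lemma space_chain_law:
  "x \<in> space S \<Longrightarrow> space (chain_law S K n x m) = space (PiM {n..n + m} (\<lambda>_. S))"
  by (rule sets_eq_imp_space_eq[OF sets_chain_law])

text \<open>Induction on \<open>m\<close> with \<open>\<psi>\<close> arbitrary: integrating out the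
  last coordinate turns the last factor and \<open>\<psi>\<close> into a new terminal function of
  the previous state. This links the law of whole paths to iterated integrals.\<close>

lemma nn_integral_chain_law:
  assumes x: "x \<in> space S" and \<phi>[measurable]: "\<And>j. \<phi> j \<in> borel_measurable S"
    and "\<psi> \<in> borel_measurable S"
  shows "(\<integral>\<^sup>+X. (\<Prod>j<m. \<phi> j (X (n + Suc j))) * \<psi> (X (n + m)) \<partial>chain_law S K n x m)
    = path_integral \<phi> m \<psi> x"
  using assms(3)
proof (induction m arbitrary: \<psi>)
  case 0
  have "(\<lambda>j\<in>{n..n}. x) \<in> space (PiM {n..n} (\<lambda>_. S))"
    using x by (auto simp: space_PiM)
  moreover have "(\<lambda>X. \<psi> (X n)) \<in> borel_measurable (PiM {n..n} (\<lambda>_. S))"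
    by (rule measurable_compose[OF measurable_component_singleton[of _ _ "\<lambda>_. S"] 0]) simp
  ultimately show ?case
    by (simp add: nn_integral_return)
next
  case (Suc m)
  note [measurable] = Suc.prems
  let ?P = "\<lambda>k. PiM {n..n + k} (\<lambda>_. S)"
  let ?\<chi> = "\<lambda>y. \<integral>\<^sup>+z. \<phi> m z * \<psi> z \<partial>K y"
  let ?f = "\<lambda>X. (\<Prod>j<Suc m. \<phi> j (X (n + Suc j))) * \<psi> (X (n + Suc m))"
  have f: "?f \<in> borel_measurable (?P (Suc m))"
    by measurable
  have \<chi>: "?\<chi> \<in> borel_measurable S"
    by (rule measurable_nn_integral_kernel) measurable
  have "(\<integral>\<^sup>+X. ?f X \<partial>chain_law S K n x (Suc m))
    = (\<integral>\<^sup>+X. \<integral>\<^sup>+Z. ?f Z \<partial>distr (K (X (n + m))) (?P (Suc m)) (\<lambda>z. X(n + Suc m := z))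
        \<partial>chain_law S K n x m)"
    unfolding chain_law.simps
    by (rule nn_integral_bind[OF f])
      (use measurable_chain_step in \<open>simp add: measurable_from_chain_law[OF x] measurable_prob_algebraD\<close>)
  also have "\<dots> = (\<integral>\<^sup>+X. (\<Prod>j<m. \<phi> j (X (n + Suc j))) * ?\<chi> (X (n + m)) \<partial>chain_law S K n x m)"
  proof (rule nn_integral_cong)
    fix X assume "X \<in> space (chain_law S K n x m)"
    then have X: "X \<in> space (?P m)" by (simp add: space_chain_law[OF x])
    then have XS: "X (n + m) \<in> space S" by (auto simp: space_PiM)
    have upd: "(\<lambda>z. X(n + Suc m := z)) \<in> K (X (n + m)) \<rightarrow>\<^sub>M ?P (Suc m)"
      using measurable_component_update[of X "{n..n + m}" "\<lambda>_. S" "n + Suc m"] X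
      by (simp add: atLeastAtMostSuc_conv measurable_cong_sets[OF sets_kernel_eq[OF XS] refl])
    have "(\<integral>\<^sup>+Z. ?f Z \<partial>distr (K (X (n + m))) (?P (Suc m)) (\<lambda>z. X(n + Suc m := z)))
        = (\<integral>\<^sup>+z. ?f (X(n + Suc m := z)) \<partial>K (X (n + m)))"
      by (rule nn_integral_distr[OF upd]) (simp add: f[simplified])
    also have "\<dots> = (\<integral>\<^sup>+z. (\<Prod>j<m. \<phi> j (X (n + Suc j))) * (\<phi> m z * \<psi> z) \<partial>K (X (n + m)))"
      by (rule nn_integral_cong) (simp add: mult.assoc)
    also have "\<dots> = (\<Prod>j<m. \<phi> j (X (n + Suc j))) * ?\<chi> (X (n + m))"
      by (rule nn_integral_cmult) (simp add: measurable_cong_sets[OF sets_kernel_eq[OF XS] refl])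
    finally show "(\<integral>\<^sup>+Z. ?f Z \<partial>distr (K (X (n + m))) (?P (Suc m)) (\<lambda>z. X(n + Suc m := z)))
        = (\<Prod>j<m. \<phi> j (X (n + Suc j))) * ?\<chi> (X (n + m))" .
  qed
  also have "\<dots> = path_integral \<phi> m ?\<chi> x"
    by (rule Suc.IH[OF \<chi>])
  finally show ?case
    by (simp add: path_integral_append[OF x] del: path_integral.simps)
qed

text \<open>Selects a subchain: in a product over \<open>j < m\<close> only the indices in residue
  class \<open>c\<close> modulo \<open>t\<close> carry \<open>u\<close>. Since factor
  \<open>j\<close> is evaluated at time \<open>n + Suc j\<close>, for \<open>c < t\<close> the first
  visit counted is at time \<open>n + c + 1\<close>.\<close>

definition every_nth :: "nat \<Rightarrow> nat \<Rightarrow> ('s \<Rightarrow> ennreal) \<Rightarrow> nat \<Rightarrow> 's \<Rightarrow> ennreal" where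
  "every_nth t c u j = (if j mod t = c then u else (\<lambda>_. 1))"

text \<open>Once the first \<open>c + 1\<close> indices are dropped, the next index that carries
  \<open>u\<close> is \<open>t - 1\<close>, whatever \<open>c\<close> was. Class
  \<open>t - 1\<close> is thus the standard form, in which the next visit is exactly
  \<open>t\<close> steps away.\<close>

lemma every_nth_shift:
  assumes "c < t"
  shows "(\<lambda>j. every_nth t c u (Suc c + j)) = every_nth t (t - 1) u"
proof -
  have "(Suc c + j) mod t = c \<longleftrightarrow> j mod t = t - 1" for j
  proof -
    \<comment> \<open>Adding \<open>c\<close> leads to residue \<open>c\<close> only from residue
      \<open>0\<close>: after wrapping around, \<open>r + c - t\<close> lies below
      \<open>c\<close>.\<close>
    have "(r + c) mod t = c \<longleftrightarrow> r = 0" if "r < t" for r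
      using assms that by (cases "r + c < t") (auto simp: le_mod_geq)
    from this[of "Suc j mod t"] have "(Suc c + j) mod t = c \<longleftrightarrow> Suc j mod t = 0"
      using assms mod_add_left_eq[of "Suc j" t c] by (simp add: add.commute del: mod_add_left_eq)
    also have "\<dots> \<longleftrightarrow> j mod t = t - 1"
      using assms by (auto simp: mod_Suc)
    finally show ?thesis .
  qed
  then show ?thesis by (simp add: every_nth_def fun_eq_iff)
qed

lemma every_nth_measurable:
  "u \<in> borel_measurable S \<Longrightarrow> every_nth t c u j \<in> borel_measurable S"
  by (simp add: every_nth_def)

text \<open>The first visit takes place after \<open>c + 1\<close> steps, so these merge into one
  power of the kernel; seen from there, the later visits form class \<open>t - 1\<close>.\<close>

lemma path_integral_every_nth:
  assumes "u \<in> borel_measurable S" and "x \<in> space S" and "c < t" and "c < m"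
  shows "path_integral (every_nth t c u) m (\<lambda>_. 1) x
    = (\<integral>\<^sup>+z. u z * path_integral (every_nth t (t - 1) u) (m - Suc c) (\<lambda>_. 1) z
        \<partial>kernel_power S K (Suc c) x)"
proof -
  have "path_integral (every_nth t c u) (Suc c + (m - Suc c)) (\<lambda>_. 1) x
    = (\<integral>\<^sup>+z. every_nth t c u c z
          * path_integral (\<lambda>j. every_nth t c u (Suc c + j)) (m - Suc c) (\<lambda>_. 1) z
        \<partial>kernel_power S K (Suc c) x)"
    by (rule path_integral_skip) (use assms in \<open>auto simp: every_nth_measurable every_nth_def\<close>)
  moreover have "Suc c + (m - Suc c) = m" "every_nth t c u c = u"
    using assms by (auto simp: every_nth_def)
  ultimately show ?thesis
    by (simp only: every_nth_shift[OF assms(3)])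
qed

lemma path_integral_every_nth_one:
  assumes "x \<in> space S" and "c < t" and "m \<le> c"
  shows "path_integral (every_nth t c u) m (\<lambda>_. 1) x = 1"
  by (rule path_integral_one) (use assms in \<open>auto simp: every_nth_def\<close>)

end

subsection \<open>Exponential moments\<close>

lemma oscillation_le_cong:
  assumes "\<And>x. x \<in> space S \<Longrightarrow> G x = H x"
  shows "oscillation_le S c G \<longleftrightarrow> oscillation_le S c H"
  using assms measurable_cong[of S G H borel] by (auto simp: oscillation_le_def)

text \<open>Hoeffding's lemma with the mean put back: \<open>G\<close> stays in an interval of
  length \<open>c\<close>.\<close>

lemma nn_integral_exp_le:
  assumes G: "oscillation_le S c G" and "prob_space \<mu>" and S: "sets \<mu> = sets S" and "0 < a"
  shows "(\<integral>\<^sup>+z. ennreal (exp (a * G z)) \<partial>\<mu>) \<le> ennreal (exp (a * (\<integral>z. G z \<partial>\<mu>) + a\<^sup>2 * c\<^sup>2 / 8))"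
proof -
  obtain lo where lo: "\<And>x. x \<in> space S \<Longrightarrow> lo \<le> G x" "\<And>x. x \<in> space S \<Longrightarrow> G x \<le> lo + c"
    using oscillation_le_interval[OF G] by blast
  have [measurable]: "G \<in> borel_measurable \<mu>"
    using oscillation_le_measurable[OF G] S by (simp cong: measurable_cong_sets)
  interpret prob_space \<mu> by fact
  interpret interval_bounded_random_variable \<mu> G lo "lo + c"
    by unfold_locales (use lo sets_eq_imp_space_eq[OF S] in auto)
  have "(\<integral>\<^sup>+z. ennreal (exp (a * G z)) \<partial>\<mu>)
      = (\<integral>\<^sup>+z. ennreal (exp (a * expectation G)) * ennreal (exp (a * (G z - expectation G))) \<partial>\<mu>)"
    by (intro nn_integral_cong) (simp add: algebra_simps flip: ennreal_mult exp_add)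
  also have "\<dots> = ennreal (exp (a * expectation G)) * (\<integral>\<^sup>+z. ennreal (exp (a * (G z - expectation G))) \<partial>\<mu>)"
    by (rule nn_integral_cmult) measurable
  also have "\<dots> \<le> ennreal (exp (a * expectation G)) * ennreal (exp (a\<^sup>2 * (lo + c - lo)\<^sup>2 / 8))"
    by (intro mult_left_mono Hoeffdings_lemma_nn_integral assms) simp
  also have "\<dots> = ennreal (exp (a * expectation G + a\<^sup>2 * c\<^sup>2 / 8))"
    by (simp add: exp_add ennreal_mult)
  finally show ?thesis .
qed

text \<open>The sum is the average over the \<open>t\<close> residue classes of \<open>t\<close>
  times the class sum, so Jensen's inequality for \<open>exp\<close> applies. This separates the
  classes although they are dependent.\<close>

lemma exp_sum_le_residue_classes:
  fixes y :: "nat \<Rightarrow> real"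
  assumes "0 < t"
  shows "exp (\<Sum>j<m. y j) \<le> (\<Sum>c<t. exp (real t * (\<Sum>j<m. if j mod t = c then y j else 0)) / real t)"
proof -
  have "(\<Sum>c<t. \<Sum>j<m. if j mod t = c then y j else 0) = (\<Sum>j<m. \<Sum>c<t. if j mod t = c then y j else 0)"
    by (rule sum.swap)
  also have "\<dots> = (\<Sum>j<m. y j)"
    using assms by (intro sum.cong refl) (simp add: sum.delta)
  finally have "(\<Sum>j<m. y j) = (\<Sum>c<t. (1 / real t) *\<^sub>R (real t * (\<Sum>j<m. if j mod t = c then y j else 0)))"
    using assms by simp
  also have "exp \<dots> \<le> (\<Sum>c<t. (1 / real t) * exp (real t * (\<Sum>j<m. if j mod t = c then y j else 0)))"
    by (rule convex_on_sum[OF _ _ exp_convex]) (use assms in \<open>auto simp: lessThan_empty_iff\<close>)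
  finally show ?thesis by simp
qed

section \<open>The potential of the chain sampled at the mixing time, and exponential
  moments\<close>

context ergodic_kernel
begin

text \<open>The expected sum of \<open>F\<close> over the first \<open>k\<close> visits of the
  sampled chain started at \<open>x\<close>, the visit at \<open>x\<close> included. It is a
  truncated solution of the Poisson equation; \<open>k\<close> will match the number of visits that
  remain.\<close>

definition partial_potential :: "('s \<Rightarrow> real) \<Rightarrow> nat \<Rightarrow> 's \<Rightarrow> real" where
  "partial_potential F k x = (\<Sum>i<k. markov_op (mixing_time S K Q * i) F x)"

lemma oscillation_le_iterates:
  assumes "oscillation_le S 1 F"
  shows "oscillation_le S ((1 / 2) ^ i) (markov_op (mixing_time S K Q * i) F)"
proof (induction i)
  case 0
  show ?case
    using assms oscillation_le_cong[of S "markov_op 0 F" F 1] markov_op_0[OF oscillation_le_measurable[OF assms]]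
    by simp
next
  case (Suc i)
  have "oscillation_le S ((1 / 2) ^ i / 2)
      (markov_op (mixing_time S K Q) (markov_op (mixing_time S K Q * i) F))"
    by (rule oscillation_le_markov_op_mixing_time[OF Suc])
  then show ?case
    using oscillation_le_cong[of S "markov_op (mixing_time S K Q * Suc i) F"]
      markov_op_add[OF assms, of _ "mixing_time S K Q" "mixing_time S K Q * i"]
    by simp
qed

text \<open>By invariance the iterate has \<open>Q\<close>-mean zero. Its value at \<open>x\<close>,
  written as an integral over the point mass at \<open>x\<close>, therefore exceeds zero by no more
  than its oscillation.\<close>

lemma iterates_le:
  assumes F: "oscillation_le S 1 F" and "(\<integral>x. F x \<partial>Q) = 0" and x: "x \<in> space S"
  shows "markov_op (mixing_time S K Q * i) F x \<le> (1 / 2) ^ i"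
proof -
  let ?G = "markov_op (mixing_time S K Q * i) F"
  have "(\<integral>z. ?G z \<partial>return S x) - (\<integral>z. ?G z \<partial>Q) \<le> (1 / 2) ^ i"
    by (rule integral_diff_le_oscillation[OF oscillation_le_iterates[OF F]])
      (use x prob_Q sets_Q in \<open>auto intro: prob_space_return\<close>)
  then show ?thesis
    using x assms oscillation_le_measurable[OF oscillation_le_markov_op[OF F]]
    by (simp add: integral_return integral_markov_op)
qed

lemma sum_half_powers_le: "(\<Sum>i<k. (1 / 2 :: real) ^ i) \<le> 2"
  by (simp add: geometric_sum)

lemma partial_potential_le:
  assumes "oscillation_le S 1 F" and "(\<integral>x. F x \<partial>Q) = 0" and "x \<in> space S"
  shows "partial_potential F k x \<le> 2"
  unfolding partial_potential_def
  using sum_mono[of "{..<k}"  "\<lambda>i. markov_op (mixing_time S K Q * i) F x" "\<lambda>i. (1 / 2) ^ i"]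
    iterates_le[OF assms] sum_half_powers_le[of k] by simp

lemma oscillation_le_partial_potential:
  assumes F: "oscillation_le S 1 F"
  shows "oscillation_le S 2 (partial_potential F k)"
  unfolding oscillation_le_def
proof (intro conjI ballI)
  show "partial_potential F k \<in> borel_measurable S"
    unfolding partial_potential_def
    by (intro borel_measurable_sum oscillation_le_measurable[OF oscillation_le_markov_op[OF F]])
  fix x y assume "x \<in> space S" "y \<in> space S"
  then have "partial_potential F k x - partial_potential F k y \<le> (\<Sum>i<k. (1 / 2) ^ i)"
    unfolding partial_potential_def sum_subtractf[symmetric]
    by (intro sum_mono oscillation_leD[OF oscillation_le_iterates[OF F]])
  then show "partial_potential F k x - partial_potential F k y \<le> 2"
    using sum_half_powers_le[of k] by simp
qed

text \<open>The visit at \<open>x\<close> contributes \<open>F x\<close>, and the other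
  \<open>k\<close> visits are counted from the state one mixing time later. This recursion lets a
  factor \<open>exp (a * F z)\<close> be absorbed into the exponential of a potential.\<close>

lemma partial_potential_Suc:
  assumes F: "oscillation_le S 1 F" and x: "x \<in> space S"
  shows "partial_potential F (Suc k) x
    = F x + markov_op (mixing_time S K Q) (partial_potential F k) x"
proof -
  let ?t = "mixing_time S K Q"
  have "markov_op ?t (partial_potential F k) x = (\<Sum>i<k. markov_op ?t (markov_op (?t * i) F) x)"
    unfolding partial_potential_def markov_op_def[of ?t]
    by (intro Bochner_Integration.integral_sum oscillation_le_integrable[OF oscillation_le_markov_op[OF F]]
        prob_space_kernel_power sets_kernel_power x)
  also have "\<dots> = (\<Sum>i<k. markov_op (?t * Suc i) F x)"
    using markov_op_add[OF F x, of ?t] by simp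
  finally show ?thesis
    using markov_op_0[OF oscillation_le_measurable[OF F] x]
    by (simp add: partial_potential_def sum.lessThan_Suc_shift del: sum.lessThan_Suc)
qed

text \<open>Strong induction on the number \<open>m\<close> of remaining steps. The first
  \<open>t\<close> steps lead to the next visit \<open>z\<close>, where the factor
  \<open>exp (a * F z)\<close> and the induction hypothesis combine into the exponential of the next
  potential. Hoeffding's lemma under the \<open>t\<close>-step kernel replaces that potential by its
  mean, at the cost of one variance term per visit.\<close>

lemma path_integral_block_bound:
  fixes a :: real
  assumes F: "oscillation_le S 1 F" and "0 < a" and "x \<in> space S"
  defines "t \<equiv> mixing_time S K Q"
  shows "path_integral (every_nth t (t - 1) (\<lambda>z. ennreal (exp (a * F z)))) m (\<lambda>_. 1) x
    \<le> ennreal (exp (a * markov_op t (partial_potential F (m div t)) x + real (m div t) * a\<^sup>2 / 2))"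
  using \<open>x \<in> space S\<close>
proof (induction m arbitrary: x rule: less_induct)
  case (less m)
  let ?u = "\<lambda>z. ennreal (exp (a * F z))"
  have t: "0 < t" using mixing_time_pos by (simp add: t_def)
  show ?case
  proof (cases "m < t")
    \<comment> \<open>With fewer than \<open>t\<close> steps left there is no further visit: the
      potential has no terms and both sides are one.\<close>
    case True
    then have "path_integral (every_nth t (t - 1) ?u) m (\<lambda>_. 1) x = 1"
      using t by (intro path_integral_every_nth_one less.prems) auto
    then show ?thesis
      using True by (simp add: partial_potential_def markov_op_def)
  next
    case False
    \<comment> \<open>The number of visits after the next one.\<close>
    define k where "k = (m - t) div t"
    have k: "m div t = Suc k"
      using False t by (simp add: k_def le_div_geq)
    have [measurable]: "F \<in> borel_measurable S"
      by (rule oscillation_le_measurable[OF F])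
    have [measurable]: "?u \<in> borel_measurable S"
      by measurable
    have "path_integral (every_nth t (t - 1) ?u) m (\<lambda>_. 1) x
      = (\<integral>\<^sup>+z. ?u z * path_integral (every_nth t (t - 1) ?u) (m - Suc (t - 1)) (\<lambda>_. 1) z
        \<partial>kernel_power S K (Suc (t - 1)) x)"
      by (rule path_integral_every_nth) (use t False less.prems in auto)
    also have "\<dots> = (\<integral>\<^sup>+z. ?u z * path_integral (every_nth t (t - 1) ?u) (m - t) (\<lambda>_. 1) z
        \<partial>kernel_power S K t x)"
      using t by (simp del: kernel_power.simps)
    also have "\<dots> \<le> (\<integral>\<^sup>+z. ennreal (exp (real k * a\<^sup>2 / 2))
        * ennreal (exp (a * partial_potential F (Suc k) z)) \<partial>kernel_power S K t x)"
    proof (rule nn_integral_mono)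
      fix z assume "z \<in> space (kernel_power S K t x)"
      then have z: "z \<in> space S" using space_kernel_power[OF less.prems] by simp
      have "?u z * path_integral (every_nth t (t - 1) ?u) (m - t) (\<lambda>_. 1) z
        \<le> ?u z * ennreal (exp (a * markov_op t (partial_potential F k) z + real k * a\<^sup>2 / 2))"
        unfolding k_def using False t less.IH[OF _ z, of "m - t"] by (intro mult_left_mono) auto
      also have "\<dots> = ennreal (exp (real k * a\<^sup>2 / 2)) * ennreal (exp (a * partial_potential F (Suc k) z))"
        by (simp add: partial_potential_Suc[OF F z] t_def algebra_simps flip: ennreal_mult exp_add)
      finally show "?u z * path_integral (every_nth t (t - 1) ?u) (m - t) (\<lambda>_. 1) z
        \<le> ennreal (exp (real k * a\<^sup>2 / 2)) * ennreal (exp (a * partial_potential F (Suc k) z))" .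
    qed
    also have "\<dots> = ennreal (exp (real k * a\<^sup>2 / 2))
        * (\<integral>\<^sup>+z. ennreal (exp (a * partial_potential F (Suc k) z)) \<partial>kernel_power S K t x)"
    proof (rule nn_integral_cmult)
      have "partial_potential F (Suc k) \<in> borel_measurable S"
        by (rule oscillation_le_measurable[OF oscillation_le_partial_potential[OF F]])
      then show "(\<lambda>z. ennreal (exp (a * partial_potential F (Suc k) z)))
          \<in> borel_measurable (kernel_power S K t x)"
        unfolding measurable_from_kernel_power[OF less.prems] by measurable
    qed
    \<comment> \<open>The potential has oscillation at most \<open>2\<close>, so the new variance
      term is \<open>a\<^sup>2 * 2\<^sup>2 / 8 = a\<^sup>2 / 2\<close>.\<close>
    also have "\<dots> \<le> ennreal (exp (real k * a\<^sup>2 / 2))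
        * ennreal (exp (a * markov_op t (partial_potential F (Suc k)) x + a\<^sup>2 * 2\<^sup>2 / 8))"
      unfolding markov_op_def
      by (intro mult_left_mono nn_integral_exp_le[OF oscillation_le_partial_potential[OF F]]
          prob_space_kernel_power sets_kernel_power less.prems \<open>0 < a\<close>) simp
    also have "\<dots> = ennreal (exp (a * markov_op t (partial_potential F (Suc k)) x + real (Suc k) * a\<^sup>2 / 2))"
      by (simp add: algebra_simps add_divide_distrib flip: ennreal_mult exp_add)
    finally show ?thesis by (simp only: k)
  qed
qed

text \<open>At the first visit the potential is bounded pointwise by \<open>2\<close>, whatever the
  start \<open>x\<close>; this costs \<open>2 * a\<close>. Only the later visits, at most
  \<open>m / t\<close> of them, incur a variance term.\<close>

lemma path_integral_every_nth_bound:
  fixes a :: real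
  assumes F: "oscillation_le S 1 F" and F0: "(\<integral>x. F x \<partial>Q) = 0" and "0 < a" and x: "x \<in> space S"
  defines "t \<equiv> mixing_time S K Q"
  assumes "c < t"
  shows "path_integral (every_nth t c (\<lambda>z. ennreal (exp (a * F z)))) m (\<lambda>_. 1) x
    \<le> ennreal (exp (2 * a + real m / real t * a\<^sup>2 / 2))"
proof (cases "m \<le> c")
  \<comment> \<open>No visit occurs: the integral is one, and the exponent on the right is
    nonnegative because \<open>a\<close> is positive.\<close>
  case True
  then show ?thesis
    using path_integral_every_nth_one[OF x \<open>c < t\<close> True] \<open>0 < a\<close> by (simp add: ennreal_1[symmetric] del: ennreal_1)
next
  case False
  let ?u = "\<lambda>z. ennreal (exp (a * F z))"
  have [measurable]: "F \<in> borel_measurable S"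
    by (rule oscillation_le_measurable[OF F])
  have [measurable]: "?u \<in> borel_measurable S"
    by measurable
  define k where "k = (m - Suc c) div t"
  have "real k \<le> real (m - Suc c) / real t"
    unfolding k_def by (rule of_nat_div_le_of_nat)
  also have "\<dots> \<le> real m / real t"
    by (intro divide_right_mono) auto
  finally have k: "real k * a\<^sup>2 \<le> real m / real t * a\<^sup>2"
    by (intro mult_right_mono) auto
  have "path_integral (every_nth t c ?u) m (\<lambda>_. 1) x
    = (\<integral>\<^sup>+z. ?u z * path_integral (every_nth t (t - 1) ?u) (m - Suc c) (\<lambda>_. 1) z
        \<partial>kernel_power S K (Suc c) x)"
    by (rule path_integral_every_nth) (use False x \<open>c < t\<close> in auto)
  also have "\<dots> \<le> (\<integral>\<^sup>+z. ennreal (exp (2 * a + real m / real t * a\<^sup>2 / 2)) \<partial>kernel_power S K (Suc c) x)"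
  proof (rule nn_integral_mono)
    fix z assume "z \<in> space (kernel_power S K (Suc c) x)"
    then have z: "z \<in> space S" by (simp only: space_kernel_power[OF x])
    have "?u z * path_integral (every_nth t (t - 1) ?u) (m - Suc c) (\<lambda>_. 1) z
      \<le> ?u z * ennreal (exp (a * markov_op t (partial_potential F k) z + real k * a\<^sup>2 / 2))"
      unfolding k_def t_def
      by (intro mult_left_mono path_integral_block_bound[OF F \<open>0 < a\<close> z]) simp
    also have "\<dots> = ennreal (exp (a * partial_potential F (Suc k) z + real k * a\<^sup>2 / 2))"
      by (simp add: partial_potential_Suc[OF F z] t_def algebra_simps flip: ennreal_mult exp_add)
    also have "\<dots> \<le> ennreal (exp (2 * a + real m / real t * a\<^sup>2 / 2))"
      using partial_potential_le[OF F F0 z, of "Suc k"] \<open>0 < a\<close> k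
      by (intro ennreal_leI) (simp add: add_mono)
    finally show "?u z * path_integral (every_nth t (t - 1) ?u) (m - Suc c) (\<lambda>_. 1) z
      \<le> ennreal (exp (2 * a + real m / real t * a\<^sup>2 / 2))" .
  qed
  also have "\<dots> = ennreal (exp (2 * a + real m / real t * a\<^sup>2 / 2))"
    using prob_space.emeasure_space_1[OF prob_space_kernel_power[OF x]]
    by (simp del: kernel_power.simps)
  finally show ?thesis .
qed

text \<open>The weight \<open>a / t\<close> cancels the factor \<open>t\<close> from Jensen's
  inequality, so each residue class contributes an exponential moment with parameter
  \<open>a\<close>. The average of \<open>t\<close> equal bounds is that bound.\<close>

lemma exponential_moment_bound:
  fixes a :: real
  assumes F: "oscillation_le S 1 F" and F0: "(\<integral>x. F x \<partial>Q) = 0" and "0 < a" and x: "x \<in> space S"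
  defines "t \<equiv> mixing_time S K Q"
  shows "(\<integral>\<^sup>+X. ennreal (exp (a / real t * (\<Sum>j<m. F (X (n + Suc j))))) \<partial>chain_law S K n x m)
    \<le> ennreal (exp (2 * a + real m / real t * a\<^sup>2 / 2))"
proof -
  have t: "0 < t" using mixing_time_pos by (simp add: t_def)
  let ?u = "\<lambda>z. ennreal (exp (a * F z))"
  have [measurable]: "F \<in> borel_measurable S"
    by (rule oscillation_le_measurable[OF F])
  have u [measurable]: "?u \<in> borel_measurable S"
    by measurable
  let ?\<Phi> = "\<lambda>c X. (\<Prod>j<m. every_nth t c ?u j (X (n + Suc j)))"
  have \<Phi>: "?\<Phi> c \<in> borel_measurable (chain_law S K n x m)" for c
    unfolding measurable_from_chain_law[OF x]
  proof (rule borel_measurable_prod_ennreal)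
    fix j assume "j \<in> {..<m}"
    then show "(\<lambda>X. every_nth t c ?u j (X (n + Suc j))) \<in> borel_measurable (PiM {n..n + m} (\<lambda>_. S))"
      by (intro measurable_compose[OF measurable_component_singleton[of _ _ "\<lambda>_. S"] every_nth_measurable[OF u]]) auto
  qed
  have "(\<integral>\<^sup>+X. ennreal (exp (a / real t * (\<Sum>j<m. F (X (n + Suc j))))) \<partial>chain_law S K n x m)
    \<le> (\<integral>\<^sup>+X. (\<Sum>c<t. ennreal (1 / real t) * ?\<Phi> c X) \<partial>chain_law S K n x m)"
  proof (rule nn_integral_mono)
    fix X
    let ?y = "\<lambda>j. a / real t * F (X (n + Suc j))"
    have "exp (real t * (\<Sum>j<m. if j mod t = c then ?y j else 0))
        = (\<Prod>j<m. if j mod t = c then exp (a * F (X (n + Suc j))) else 1)" for c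
      unfolding sum_distrib_left exp_sum[OF finite_lessThan]
      using t by (intro prod.cong) auto
    moreover have "?\<Phi> c X = ennreal (\<Prod>j<m. if j mod t = c then exp (a * F (X (n + Suc j))) else 1)" for c
      by (subst prod_ennreal[symmetric]) (auto simp: every_nth_def intro!: prod.cong)
    ultimately have \<Phi>_eq: "ennreal (1 / real t) * ?\<Phi> c X
        = ennreal (exp (real t * (\<Sum>j<m. if j mod t = c then ?y j else 0)) / real t)" for c
      by (simp flip: ennreal_mult')
    have "a / real t * (\<Sum>j<m. F (X (n + Suc j))) = (\<Sum>j<m. ?y j)"
      by (simp add: sum_distrib_left)
    then show "ennreal (exp (a / real t * (\<Sum>j<m. F (X (n + Suc j)))))
        \<le> (\<Sum>c<t. ennreal (1 / real t) * ?\<Phi> c X)"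
      unfolding \<Phi>_eq using exp_sum_le_residue_classes[OF t, of ?y m]
      by (subst sum_ennreal) (auto intro: ennreal_leI)
  qed
  also have "\<dots> = (\<Sum>c<t. ennreal (1 / real t) * (\<integral>\<^sup>+X. ?\<Phi> c X \<partial>chain_law S K n x m))"
    using \<Phi> by (simp add: nn_integral_sum nn_integral_cmult)
  also have "\<dots> \<le> (\<Sum>c<t. ennreal (1 / real t) * ennreal (exp (2 * a + real m / real t * a\<^sup>2 / 2)))"
  proof (intro sum_mono mult_left_mono)
    fix c assume "c \<in> {..<t}"
    then have c: "c < t" by simp
    \<comment> \<open>The product over the path is a path integral with terminal function
      one.\<close>
    show "(\<integral>\<^sup>+X. ?\<Phi> c X \<partial>chain_law S K n x m) \<le> ennreal (exp (2 * a + real m / real t * a\<^sup>2 / 2))"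
      using path_integral_every_nth_bound[OF F F0 \<open>0 < a\<close> x c[unfolded t_def], of m]
        nn_integral_chain_law[where \<phi>="every_nth t c ?u", OF x every_nth_measurable[OF u], of "\<lambda>_. 1" n m]
      by (simp add: t_def)
  qed simp
  also have "\<dots> = ennreal (exp (2 * a + real m / real t * a\<^sup>2 / 2))"
    using t by (simp add: ennreal_of_nat_eq_real_of_nat flip: ennreal_mult' ennreal_mult)
  finally show ?thesis .
qed

text \<open>With \<open>M = m * \<epsilon>\<^sup>2 / t\<close>, a Chernoff bound works for large
  \<open>M\<close>, and the claim is trivial otherwise. For parameter \<open>a\<close> the exponent
  is \<open>2 * a - a * m * \<epsilon> / t + m * a\<^sup>2 / (2 * t)\<close>; the choice
  \<open>a = \<epsilon>\<close> minimizes the last two terms and leaves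
  \<open>2 * \<epsilon> - M / 2\<close>.\<close>

lemma deviation_bound:
  fixes \<epsilon> :: real
  assumes F: "oscillation_le S 1 F" and F0: "(\<integral>x. F x \<partial>Q) = 0" and x: "x \<in> space S"
    and "0 \<le> \<epsilon>" "\<epsilon> \<le> 1"
  defines "t \<equiv> mixing_time S K Q"
  shows "measure (chain_law S K n x m)
      {X \<in> space (chain_law S K n x m). real m * \<epsilon> < (\<Sum>j<m. F (X (n + Suc j)))}
    \<le> 3 * exp (- (real m * \<epsilon>\<^sup>2 / (9 * real t)))"
proof -
  have t: "0 < t" using mixing_time_pos by (simp add: t_def)
  interpret P: prob_space "chain_law S K n x m" by (rule prob_space_chain_law[OF x])
  let ?A = "{X \<in> space (chain_law S K n x m). real m * \<epsilon> < (\<Sum>j<m. F (X (n + Suc j)))}"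
  define M where "M = real m * \<epsilon>\<^sup>2 / real t"
  have M: "real m * \<epsilon>\<^sup>2 / (9 * real t) = M / 9"
    by (simp add: M_def)
  show ?thesis
  \<comment> \<open>Up to the threshold \<open>9\<close> the right-hand side is at least
    \<open>3 / exp 1\<close>, hence at least one.\<close>
  proof (cases "M \<le> 9")
    case True
    have "1 \<le> 3 * exp (-1 :: real)"
      using exp_le by (simp add: exp_minus field_simps)
    also have "\<dots> \<le> 3 * exp (- (M / 9))"
      using True by simp
    finally show ?thesis
      unfolding M using P.prob_le_1[of ?A] by linarith
  next
    case False
    then have "\<epsilon> \<noteq> 0" by (auto simp: M_def)
    then have \<epsilon>: "0 < \<epsilon>" using \<open>0 \<le> \<epsilon>\<close> by simp
    have "(\<lambda>X. F (X (n + Suc j))) \<in> borel_measurable (chain_law S K n x m)" if "j < m" for j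
      unfolding measurable_from_chain_law[OF x] using that
      by (intro measurable_compose[OF measurable_component_singleton[of _ _ "\<lambda>_. S"]
            oscillation_le_measurable[OF F]]) auto
    then have [measurable]: "(\<lambda>X. \<Sum>j<m. F (X (n + Suc j))) \<in> borel_measurable (chain_law S K n x m)"
      by (intro borel_measurable_sum) auto
    have A: "?A \<in> sets (chain_law S K n x m)" by measurable
    have "ennreal (measure (chain_law S K n x m) ?A) = (\<integral>\<^sup>+X. indicator ?A X \<partial>chain_law S K n x m)"
      using A by (simp add: P.emeasure_eq_measure)
    \<comment> \<open>Markov's inequality for the exponential: on the event,
      \<open>\<epsilon> / t\<close> times the sum is at least
      \<open>\<epsilon> / t * (m * \<epsilon>) = M\<close>.\<close>
    also have "\<dots> \<le> (\<integral>\<^sup>+X. ennreal (exp (- M))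
        * ennreal (exp (\<epsilon> / real t * (\<Sum>j<m. F (X (n + Suc j))))) \<partial>chain_law S K n x m)"
    proof (rule nn_integral_mono)
      fix X
      show "indicator ?A X \<le> ennreal (exp (- M)) * ennreal (exp (\<epsilon> / real t * (\<Sum>j<m. F (X (n + Suc j)))))"
      proof (cases "X \<in> ?A")
        case True
        then have "\<epsilon> / real t * (real m * \<epsilon>) \<le> \<epsilon> / real t * (\<Sum>j<m. F (X (n + Suc j)))"
          using \<epsilon> by (intro mult_left_mono) auto
        then have "M \<le> \<epsilon> / real t * (\<Sum>j<m. F (X (n + Suc j)))"
          by (simp add: M_def power2_eq_square mult_ac)
        then have "ennreal 1 \<le> ennreal (exp (- M + \<epsilon> / real t * (\<Sum>j<m. F (X (n + Suc j)))))"
          by (intro ennreal_leI) simp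
        then have "1 \<le> ennreal (exp (- M)) * ennreal (exp (\<epsilon> / real t * (\<Sum>j<m. F (X (n + Suc j)))))"
          by (simp only: exp_add ennreal_mult exp_ge_zero ennreal_1)
        then show ?thesis
          using True by simp
      qed simp
    qed
    also have "\<dots> = ennreal (exp (- M))
        * (\<integral>\<^sup>+X. ennreal (exp (\<epsilon> / real t * (\<Sum>j<m. F (X (n + Suc j))))) \<partial>chain_law S K n x m)"
      by (rule nn_integral_cmult) measurable
    also have "\<dots> \<le> ennreal (exp (- M)) * ennreal (exp (2 * \<epsilon> + real m / real t * \<epsilon>\<^sup>2 / 2))"
      unfolding t_def by (intro mult_left_mono exponential_moment_bound[OF F F0 \<epsilon> x]) simp
    also have "\<dots> = ennreal (exp (2 * \<epsilon> - M / 2))"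
      by (simp add: M_def algebra_simps flip: ennreal_mult exp_add)
    finally have "measure (chain_law S K n x m) ?A \<le> exp (2 * \<epsilon> - M / 2)"
      by (simp add: ennreal_le_iff)
    \<comment> \<open>Here \<open>2 * \<epsilon> \<le> 2\<close>, while
      \<open>M / 2 - M / 9 = 7 * M / 18\<close> exceeds \<open>7 / 2\<close>.\<close>
    also have "\<dots> \<le> exp (- (M / 9))"
      using False \<open>\<epsilon> \<le> 1\<close> by simp
    also have "\<dots> \<le> 3 * exp (- (M / 9))" by simp
    finally show ?thesis unfolding M .
  qed
qed

end

subsection \<open>The block chain\<close>

text \<open>The condition \<open>k \<le> p\<close> keeps each index \<open>i - 1\<close> with
  \<open>i\<close> in \<open>{1..k}\<close> inside \<open>{0..p}\<close>. In the shift the truncated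
  difference \<open>0 - 1\<close> never matters, since lag \<open>0\<close> receives the fresh value
  \<open>z\<close>.\<close>

lemma measurable_block_kernel:
  fixes \<kappa> :: "(nat \<Rightarrow> 'y::topological_space) \<Rightarrow> 'y measure"
  assumes \<kappa>: "\<kappa> \<in> PiM {1..k} (\<lambda>_. borel) \<rightarrow>\<^sub>M prob_algebra borel" and "k \<le> p"
  shows "block_kernel k \<kappa> p \<in> block_space p \<rightarrow>\<^sub>M prob_algebra (block_space p)"
proof -
  have coord: "(\<lambda>x. x j) \<in> block_space p \<rightarrow>\<^sub>M (borel :: 'y measure)" if "j \<le> p" for j
    unfolding block_space_def using that by (intro measurable_component_singleton) auto
  have "(\<lambda>x. distr (\<kappa> (\<lambda>i\<in>{1..k}. x (i - 1))) (block_space p)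
        (\<lambda>z. \<lambda>i\<in>{0..p}. if i = 0 then z else x (i - 1)))
      \<in> block_space p \<rightarrow>\<^sub>M prob_algebra (block_space p)"
  proof (rule measurable_distr_prob_space2)
    show "(\<lambda>x. \<kappa> (\<lambda>i\<in>{1..k}. x (i - 1))) \<in> block_space p \<rightarrow>\<^sub>M prob_algebra borel"
      by (rule measurable_compose[OF measurable_restrict \<kappa>]) (use \<open>k \<le> p\<close> in \<open>auto intro!: coord\<close>)
    show "(\<lambda>(x, z :: 'y). \<lambda>i\<in>{0..p}. if i = 0 then z else x (i - 1))
        \<in> block_space p \<Otimes>\<^sub>M borel \<rightarrow>\<^sub>M block_space p"
    proof -
      have "(\<lambda>xz. \<lambda>i\<in>{0..p}. if i = 0 then snd xz else fst xz (i - 1))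
          \<in> block_space p \<Otimes>\<^sub>M borel \<rightarrow>\<^sub>M PiM {0..p} (\<lambda>_. borel :: 'y measure)"
      proof (rule measurable_restrict)
        fix i assume "i \<in> {0..p}"
        then show "(\<lambda>xz. if i = 0 then snd xz else fst xz (i - 1))
            \<in> block_space p \<Otimes>\<^sub>M borel \<rightarrow>\<^sub>M (borel :: 'y measure)"
          using measurable_compose[OF measurable_fst[of "block_space p" "borel :: 'y measure"] coord[of "i - 1"]] by (cases "i = 0") auto
      qed
      then show ?thesis
        by (simp add: case_prod_beta' flip: block_space_def)
    qed
  qed
  then show ?thesis
    unfolding block_kernel_def[abs_def] .
qed

lemma measurable_prediction_loss:
  fixes L :: "'y::topological_space \<times> 'y \<Rightarrow> real"
  assumes L: "loss_function L" and g: "g \<in> prediction_functions p"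
  shows "prediction_loss L p g \<in> borel_measurable (block_space p)"
proof -
  have "(\<lambda>x. \<lambda>i\<in>{1..p}. x i) \<in> block_space p \<rightarrow>\<^sub>M PiM {1..p} (\<lambda>_. borel :: 'y measure)"
    unfolding block_space_def by (rule measurable_restrict) (auto intro!: measurable_component_singleton)
  from measurable_compose[OF this g[unfolded prediction_functions_def]]
  have "(\<lambda>x. (g (\<lambda>i\<in>{1..p}. x i), x 0)) \<in> block_space p \<rightarrow>\<^sub>M borel \<Otimes>\<^sub>M borel"
    by (rule measurable_Pair) (simp add: block_space_def)
  then show ?thesis
    using L unfolding prediction_loss_def[abs_def] loss_function_def
    by (auto intro: measurable_compose)
qed

lemma block_in_space: "block p y t \<in> space (block_space p)"
  by (simp add: block_def block_space_def space_PiM)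

section \<open>Concentration of the validation loss around the expected loss\<close>

theorem theorem3p1:
  fixes M :: "'a measure"
    and Y :: "int \<Rightarrow> 'a \<Rightarrow> 'y::polish_space"
    and \<kappa> :: "(nat \<Rightarrow> 'y) \<Rightarrow> 'y measure"
    and K :: "(nat \<Rightarrow> 'y) \<Rightarrow> (nat \<Rightarrow> 'y) measure"
    and Q :: "(nat \<Rightarrow> 'y) measure"
    and k\<^sub>0 p n m t\<^sub>m\<^sub>i\<^sub>x :: nat
    and L L' :: "'y \<times> 'y \<Rightarrow> real"
    and \<G> :: "((nat \<Rightarrow> 'y) \<Rightarrow> 'y) set"
    and y :: "int \<Rightarrow> 'y"
    and x :: "nat \<Rightarrow> nat \<Rightarrow> 'y"
    and g :: "(nat \<Rightarrow> 'y) \<Rightarrow> 'y"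
    and \<epsilon> s :: real
  defines "K \<equiv> block_kernel k\<^sub>0 \<kappa> p"
    and "Q \<equiv> block_law M Y p"
    and "t\<^sub>m\<^sub>i\<^sub>x \<equiv> mixing_time (block_space p) K Q"
    and "x \<equiv> \<lambda>t. block p y (int t)"
  assumes "prob_space M"
    and "markov_chain_of_order M k\<^sub>0 \<kappa> Y"
    and "stationary_process M Y"
    and "k\<^sub>0 \<le> p"
    and "uniformly_ergodic (block_space p) K Q"
    and "loss_function L" and "loss_function L'"
    and "\<G> \<subseteq> prediction_functions p"
    and "1 \<le> n"
    and "is_arg_min (\<lambda>g. \<Sum>t = 1..n. prediction_loss L' p g (x t)) (\<lambda>g. g \<in> \<G>) g"
    and "1 \<le> m"
    and "0 \<le> \<epsilon>" and "\<epsilon> \<le> 1"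
    and "s \<in> {1, - 1}"
  shows "measure (chain_law (block_space p) K n (x n) m)
           {X \<in> space (chain_law (block_space p) K n (x n) m).
              s * (validation_loss L p n m g X - expected_loss L p Q g) > \<epsilon>}
         \<le> (2 * exp (ln 2 / real t\<^sub>m\<^sub>i\<^sub>x) + 1)
             * exp (- (real m * \<epsilon>\<^sup>2 * ln 2) / ((1 + 9 * ln 2) * real t\<^sub>m\<^sub>i\<^sub>x))"
proof -
  define f where "f = prediction_loss L p g"
  have \<kappa>: "\<kappa> \<in> PiM {1..k\<^sub>0} (\<lambda>_. borel) \<rightarrow>\<^sub>M prob_algebra borel" and Y: "\<And>t. Y t \<in> M \<rightarrow>\<^sub>M borel"
    using \<open>markov_chain_of_order M k\<^sub>0 \<kappa> Y\<close> by (auto simp: markov_chain_of_order_def)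
  have block: "(\<lambda>\<omega>. block p (\<lambda>t. Y t \<omega>) 0) \<in> M \<rightarrow>\<^sub>M block_space p"
    unfolding block_def block_space_def by (rule measurable_restrict) (rule Y)
  interpret ergodic_kernel "block_space p" K Q
  proof (intro ergodic_kernel.intro markov_kernel.intro ergodic_kernel_axioms.intro)
    show "K \<in> block_space p \<rightarrow>\<^sub>M prob_algebra (block_space p)"
      unfolding K_def by (rule measurable_block_kernel[OF \<kappa> \<open>k\<^sub>0 \<le> p\<close>])
    show "prob_space Q"
      unfolding Q_def block_law_def by (rule prob_space.prob_space_distr[OF \<open>prob_space M\<close> block])
    show "sets Q = sets (block_space p)"
      by (simp add: Q_def block_law_def)
  qed fact
  interpret Q: prob_space Q by (rule prob_Q)
  have g: "g \<in> prediction_functions p"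
    using \<open>is_arg_min _ _ g\<close> \<open>\<G> \<subseteq> prediction_functions p\<close> by (auto simp: is_arg_min_def)
  have [measurable]: "f \<in> borel_measurable (block_space p)"
    unfolding f_def by (rule measurable_prediction_loss[OF \<open>loss_function L\<close> g])
  have f01: "0 \<le> f z" "f z \<le> 1" for z
    using \<open>loss_function L\<close> by (auto simp: f_def prediction_loss_def loss_function_def)
  \<comment> \<open>Centring gives \<open>Q\<close>-mean zero, and the sign \<open>s\<close> turns
    both tails into an upper tail. The oscillation stays at most one because \<open>f\<close> has
    values in \<open>[0, 1]\<close>.\<close>
  define F where "F z = s * (f z - (\<integral>z. f z \<partial>Q))" for z
  have "f z - f z' \<le> 1" for z z'
    using f01[of z] f01[of z'] by linarith
  then have f_osc: "oscillation_le (block_space p) 1 f" and F_osc: "oscillation_le (block_space p) 1 F"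
    using \<open>s \<in> {1, - 1}\<close> by (auto simp: oscillation_le_def F_def[abs_def])
  have F0: "(\<integral>z. F z \<partial>Q) = 0"
    using oscillation_le_integrable[OF f_osc prob_Q sets_Q] by (simp add: F_def Q.prob_space)
  \<comment> \<open>The times \<open>n + 1\<close> to \<open>n + m\<close> are reindexed from zero
    and the factor \<open>1 / m\<close> is cleared, which \<open>1 \<le> m\<close> permits.\<close>
  have event: "s * (validation_loss L p n m g X - expected_loss L p Q g) > \<epsilon>
      \<longleftrightarrow> real m * \<epsilon> < (\<Sum>j<m. F (X (n + Suc j)))" for X
  proof -
    have "(\<Sum>j = n + 1..n + m. f (X j)) = (\<Sum>j<m. f (X (n + Suc j)))"
      by (rule sum.reindex_bij_witness[of _ "\<lambda>j. n + Suc j" "\<lambda>j. j - Suc n"]) auto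
    then have "(\<Sum>j<m. F (X (n + Suc j)))
        = real m * (s * (validation_loss L p n m g X - expected_loss L p Q g))"
      using \<open>1 \<le> m\<close>
      by (simp add: F_def validation_loss_def expected_loss_def sum_subtractf
          right_diff_distrib flip: f_def sum_distrib_left)
    then show ?thesis
      using \<open>1 \<le> m\<close> by simp
  qed
  have "measure (chain_law (block_space p) K n (x n) m)
           {X \<in> space (chain_law (block_space p) K n (x n) m).
              s * (validation_loss L p n m g X - expected_loss L p Q g) > \<epsilon>}
      \<le> 3 * exp (- (real m * \<epsilon>\<^sup>2 / (9 * real t\<^sub>m\<^sub>i\<^sub>x)))"
    unfolding event t\<^sub>m\<^sub>i\<^sub>x_def
    by (rule deviation_bound[OF F_osc F0 _ \<open>0 \<le> \<epsilon>\<close> \<open>\<epsilon> \<le> 1\<close>]) (simp add: x_def block_in_space)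
  \<comment> \<open>The prefactor is at least \<open>3\<close> because its exponential is at least
    one, and the rate satisfies \<open>ln 2 / (1 + 9 * ln 2) \<le> 1 / 9\<close>.\<close>
  also have "\<dots> \<le> (2 * exp (ln 2 / real t\<^sub>m\<^sub>i\<^sub>x) + 1)
      * exp (- (real m * \<epsilon>\<^sup>2 * ln 2) / ((1 + 9 * ln 2) * real t\<^sub>m\<^sub>i\<^sub>x))"
  proof (rule mult_mono)
    have "0 < 1 + 9 * ln (2 :: real)"
      by (simp add: add_pos_pos)
    then have "ln 2 / (1 + 9 * ln 2) \<le> 1 / (9 :: real)"
      by (simp add: pos_divide_le_eq)
    then have "(real m * \<epsilon>\<^sup>2 / real t\<^sub>m\<^sub>i\<^sub>x) * (ln 2 / (1 + 9 * ln 2)) \<le> (real m * \<epsilon>\<^sup>2 / real t\<^sub>m\<^sub>i\<^sub>x) * (1 / 9)"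
      by (intro mult_left_mono) auto
    then show "exp (- (real m * \<epsilon>\<^sup>2 / (9 * real t\<^sub>m\<^sub>i\<^sub>x)))
        \<le> exp (- (real m * \<epsilon>\<^sup>2 * ln 2) / ((1 + 9 * ln 2) * real t\<^sub>m\<^sub>i\<^sub>x))"
      by (simp add: mult_ac)
  qed auto
  finally show ?thesis .
qed

end
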